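(* Let $\mathbf K$ be an AEC and $\lambda\geq\operatorname{LS}(\mathbf K)$ such that $\mathbf K$ is stable in $\lambda$ and $\mathbf K_\lambda$ has amalgamation, joint embedding and no maximal models. Let $\mathcal I$ be an independence relation on $\mathbf K_\lambda$ satisfying uniqueness, extension, universal continuity, and $(\geq\kappa)$-local character for some regular $\kappa\leq\lambda$. Suppose $\mathbf K$ is $\aleph_0$-tame. Let $\delta_1,\delta_2<\lambda^+$ be limit ordinals. If $\operatorname{cf}(\delta_1)<\kappa(\mathcal I,\mathbf K_\lambda,\leq^u_{\mathbf K})$ and $\operatorname{cf}(\delta_1)\neq\operatorname{cf}(\delta_2)$, then the $(\lambda,\delta_1)$-limit model is not isomorphic to the $(\lambda,\delta_2)$-limit model.
   Context: $\mathbf K=(K,\leq_{\mathbf K})$ is an AEC; $\mathbf K_\lambda$ its models of cardinality $\lambda$; $\mathbf{gtp}$, $\mathbf{gS}(M)$ denote Galois types; $\mathbf K$ is stable in $\lambda$ if $|\mathbf{gS}(M)|\leq\lambda$ for all $M\in K_\lambda$. $\mathbf K$ is $(<\theta)$-tame if for all $M\in K$ and $p,q\in\mathbf{gS}(M)$, $p\upharpoonright A=q\upharpoonright A$ for all $A\subseteq|M|$ with $|A|<\theta$ implies $p=q$; $\theta$-tame means $(<\theta^+)$-tame. For $M_0,M\in K_\lambda$, $M_0\leq^u_{\mathbf K}M$ means $M_0\leq_{\mathbf K}M$ and every $N\in K_\lambda$ extending $M_0$ embeds into $M$ over $M_0$. A $(\lambda,\delta)$-limit model ($\delta<\lambda^+$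 limit) is $M_\delta$ for some $\leq_{\mathbf K}$-increasing continuous chain $\langle M_i:i\leq\delta\rangle$ in $K_\lambda$ with $M_i\leq^u_{\mathbf K}M_{i+1}$ for all $i<\delta$. An independence relation $\mathcal I$ on $\mathbf K_\lambda$ is a relation on tuples $(M_0,a,M,N)$ with $M_0\leq M\leq N$ in $K_\lambda$, $a\in N$, satisfying invariance under isomorphism, monotonicity (may shrink $M$ to any $M_1$ with $M_0\leq M_1\leq M$ and shrink or enlarge $N$ keeping $M\leq N$, $a\in N$) and base monotonicity (may enlarge $M_0$ to any $M_1\leq M$). $p\in\mathbf{gS}(M)$ does not $\mathcal I$-fork over $M_0$ if $p=\mathbf{gtp}(a/M,N)$ with $\mathcal I(M_0,a,M,N)$. Uniqueness: two types over $N$ not $\mathcal I$-forking over $M\leq N$ with equal restrictions to $M$ are equal. Extension: if $M_0\leq M\leq N$ and $p\in\mathbf{gS}(M)$ does not $\mathcal I$-fork over $M_0$ then some extension $q\in\mathbf{gS}(N)$ of $p$ does not $\mathcal I$-fork over $M_0$. For regular $\gamma$: $\gamma$-local character: for every $\leq^u_{\mathbf K}$-increasing $\langle M_i:i<\gamma\rangle$ in $K_\lambda$ with union $M_\gamma\in K_\lambda$ and every $p\in\mathbf{gS}(M_\gamma)$, $p$ does not $\mathcal I$-fork over some $M_i$; $\gamma$-universal continuity: for such a chain and $p\in\mathbf{gS}(M_\gamma)$, if $p\upharpoonright M_i$ does not $\mathcal I$-fork over $M_0$ for all $i<\gamma$ then $p$ does not $\mathcal I$-fork over $M_0$. $(\geq\kappa)$-local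 character: $\gamma$-local character for all regular $\gamma\geq\kappa$; universal continuity: $\gamma$-universal continuity for all infinite regular $\gamma$. $\underline\kappa(\mathcal I,\mathbf K_\lambda,\leq^u_{\mathbf K})$ is the set of $\delta<\lambda^+$ such that whenever $\langle M_i:i\leq\delta\rangle$ is a $\leq^u_{\mathbf K}$-increasing continuous chain in $K_\lambda$ and $p\in\mathbf{gS}(M_\delta)$, there is $i<\delta$ with $p$ not $\mathcal I$-forking over $M_i$. $\kappa(\mathcal I,\mathbf K_\lambda,\leq^u_{\mathbf K})$ is the least $\mu\leq\lambda$ such that every regular cardinal in $[\mu,\lambda^+)$ lies in $\underline\kappa(\mathcal I,\mathbf K_\lambda,\leq^u_{\mathbf K})$ (and $\infty$ if none exists). *)

theory Defs
  imports Main
begin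

unbundle cardinal_syntax

text \<open>
  Encoding. An AEC is a class of structures whose universes are subsets of an infinite type 'a,
  which plays the role of the class of all sets. A cardinal \<open>\<lambda>\<close> is considered together with the
  requirement \<open>\<lambda> <o |UNIV :: 'a set|\<close>, which leaves room for the isomorphic copies of models of
  size \<open>\<lambda>\<close> that occur in the definitions. Ordinals are well-orders (\<^const>\<open>Well_order\<close>) on subsets
  of 'a, cardinals are those with \<^const>\<open>Card_order\<close>, both compared by \<open>\<le>o\<close>, \<open><o\<close>, \<open>=o\<close>; every
  ordinal below \<open>\<lambda>\<^sup>+\<close> is represented. The \<open>i < \<delta>\<close> are the elements of \<open>Field \<delta>\<close>.
\<close>

section \<open>Ordinals and cardinals\<close>

definition limit_ord :: "'a rel \<Rightarrow> bool" where
  "limit_ord d \<longleftrightarrow> Well_order d \<and> Field d \<noteq> {} \<and> cofinal (Field d) d"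

text \<open>The ordinal that an element \<open>i\<close> of a well-order stands for.\<close>

definition ord_of :: "'a rel \<Rightarrow> 'a \<Rightarrow> 'a rel" where
  "ord_of d i = Restr d (underS d i)"

definition ord_zero :: "'a rel \<Rightarrow> 'a" where
  "ord_zero d = wo_rel.minim d (Field d)"

definition ord_suc :: "'a rel \<Rightarrow> 'a \<Rightarrow> 'a" where
  "ord_suc d i = wo_rel.suc d {i}"

definition cf :: "'a rel \<Rightarrow> 'a rel" where
  "cf d = |SOME A. A \<subseteq> Field d \<and> cofinal A d \<and>
                   (\<forall>B. B \<subseteq> Field d \<and> cofinal B d \<longrightarrow> |A| \<le>o |B| )|"

definition regular_cardinal :: "'a rel \<Rightarrow> bool" where
  "regular_cardinal r \<longleftrightarrow> Cinfinite r \<and> regularCard r"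

section \<open>Structures\<close>

record 's vocab =
  Funs :: "'s set"
  Rels :: "'s set"
  arity :: "'s \<Rightarrow> nat"

record ('s, 'a) struct =
  univ :: "'a set"
  fn :: "'s \<Rightarrow> 'a list \<Rightarrow> 'a"
  rl :: "'s \<Rightarrow> 'a list set"

definition args :: "'s vocab \<Rightarrow> 's \<Rightarrow> 'a set \<Rightarrow> 'a list set" where
  "args V s A = {xs. length xs = arity V s \<and> set xs \<subseteq> A}"

text \<open>The interpretations take default values off their domains, so that structures with the same
  universe and interpretations are equal.\<close>

definition is_struct :: "'s vocab \<Rightarrow> ('s, 'a) struct \<Rightarrow> bool" where
  "is_struct V M \<longleftrightarrow>
     (\<forall>s xs. if s \<in> Funs V \<and> xs \<in> args V s (univ M) then fn M s xs \<in> univ M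
             else fn M s xs = undefined) \<and>
     (\<forall>s. if s \<in> Rels V then rl M s \<subseteq> args V s (univ M) else rl M s = {})"

definition substruct :: "'s vocab \<Rightarrow> ('s, 'a) struct \<Rightarrow> ('s, 'a) struct \<Rightarrow> bool" where
  "substruct V M N \<longleftrightarrow> is_struct V M \<and> is_struct V N \<and> univ M \<subseteq> univ N \<and>
     (\<forall>s\<in>Funs V. \<forall>xs\<in>args V s (univ M). fn M s xs = fn N s xs) \<and>
     (\<forall>s\<in>Rels V. rl M s = rl N s \<inter> args V s (univ M))"

definition struct_iso :: "'s vocab \<Rightarrow> ('a \<Rightarrow> 'a) \<Rightarrow> ('s, 'a) struct \<Rightarrow> ('s, 'a) struct \<Rightarrow> bool" where
  "struct_iso V f M N \<longleftrightarrow> is_struct V M \<and> is_struct V N \<and> bij_betw f (univ M) (univ N) \<and>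
     (\<forall>s\<in>Funs V. \<forall>xs\<in>args V s (univ M). f (fn M s xs) = fn N s (map f xs)) \<and>
     (\<forall>s\<in>Rels V. \<forall>xs\<in>args V s (univ M). xs \<in> rl M s \<longleftrightarrow> map f xs \<in> rl N s)"

definition isomorphic :: "'s vocab \<Rightarrow> ('s, 'a) struct \<Rightarrow> ('s, 'a) struct \<Rightarrow> bool" where
  "isomorphic V M N \<longleftrightarrow> (\<exists>f. struct_iso V f M N)"

text \<open>Union of a chain of structures. The value of a function is computed in any member that
  contains the arguments.\<close>

definition union_struct ::
    "'s vocab \<Rightarrow> 'i set \<Rightarrow> ('i \<Rightarrow> ('s, 'a) struct) \<Rightarrow> ('s, 'a) struct" where
  "union_struct V I M =
     \<lparr>univ = (\<Union>i\<in>I. univ (M i)),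
      fn = (\<lambda>s xs. if s \<in> Funs V \<and> xs \<in> args V s (\<Union>i\<in>I. univ (M i))
                   then fn (M (SOME i. i \<in> I \<and> set xs \<subseteq> univ (M i))) s xs else undefined),
      rl = (\<lambda>s. \<Union>i\<in>I. rl (M i) s)\<rparr>"

section \<open>Abstract elementary classes\<close>

record ('s, 'a) aec =
  voc :: "'s vocab"
  mods :: "('s, 'a) struct set"
  le :: "('s, 'a) struct \<Rightarrow> ('s, 'a) struct \<Rightarrow> bool"

definition increasing ::
    "(('s, 'a) struct \<Rightarrow> ('s, 'a) struct \<Rightarrow> bool) \<Rightarrow> 'a rel \<Rightarrow> ('a \<Rightarrow> ('s, 'a) struct) \<Rightarrow> bool" where
  "increasing R d M \<longleftrightarrow> (\<forall>i j. (i, j) \<in> d \<and> i \<noteq> j \<longrightarrow> R (M i) (M j))"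

definition LS_number :: "('s, 'a) aec \<Rightarrow> 'a rel \<Rightarrow> bool" where
  "LS_number K m \<longleftrightarrow> Cinfinite m \<and> |Funs (voc K) \<union> Rels (voc K)| \<le>o m \<and>
     (\<forall>M\<in>mods K. \<forall>A. A \<subseteq> univ M \<longrightarrow>
        (\<exists>N. le K N M \<and> A \<subseteq> univ N \<and> |univ N| \<le>o |A| +c m))"

definition LS :: "('s, 'a) aec \<Rightarrow> 'a rel" where
  "LS K = (SOME m. LS_number K m \<and> (\<forall>n. LS_number K n \<longrightarrow> m \<le>o n))"

text \<open>The conjuncts are: \<open>\<le>\<^sub>K\<close> is a partial order on \<open>K\<close> refining the substructure relation,
  closure under isomorphism, coherence, the Tarski-Vaught chain axioms and the
  Loewenheim-Skolem-Tarski axiom.\<close>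

definition is_aec :: "('s, 'a) aec \<Rightarrow> bool" where
  "is_aec K \<longleftrightarrow>
     (\<forall>M\<in>mods K. is_struct (voc K) M) \<and>
     (\<forall>M N. le K M N \<longrightarrow> M \<in> mods K \<and> N \<in> mods K \<and> substruct (voc K) M N) \<and>
     (\<forall>M\<in>mods K. le K M M) \<and>
     (\<forall>M N. le K M N \<and> le K N M \<longrightarrow> M = N) \<and>
     (\<forall>M N P. le K M N \<and> le K N P \<longrightarrow> le K M P) \<and>
     (\<forall>f M M'. M \<in> mods K \<and> struct_iso (voc K) f M M' \<longrightarrow> M' \<in> mods K) \<and>
     (\<forall>f M N M' N'. le K M N \<and> struct_iso (voc K) f N N' \<and> struct_iso (voc K) f M M' \<longrightarrow> le K M' N') \<and>
     (\<forall>M0 M1 M2. le K M0 M2 \<and> le K M1 M2 \<and> univ M0 \<subseteq> univ M1 \<longrightarrow> le K M0 M1) \<and>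
     (\<forall>d M. limit_ord d \<and> (\<forall>i\<in>Field d. M i \<in> mods K) \<and> increasing (le K) d M \<longrightarrow>
        union_struct (voc K) (Field d) M \<in> mods K \<and>
        (\<forall>i\<in>Field d. le K (M i) (union_struct (voc K) (Field d) M)) \<and>
        (\<forall>N\<in>mods K. (\<forall>i\<in>Field d. le K (M i) N) \<longrightarrow>
           le K (union_struct (voc K) (Field d) M) N)) \<and>
     (\<exists>m. LS_number K m)"

definition K_at :: "('s, 'a) aec \<Rightarrow> 'a rel \<Rightarrow> ('s, 'a) struct set" where
  "K_at K l = {M \<in> mods K. |univ M| =o l}"

definition emb_over ::
    "('s, 'a) aec \<Rightarrow> 'a set \<Rightarrow> ('a \<Rightarrow> 'a) \<Rightarrow> ('s, 'a) struct \<Rightarrow> ('s, 'a) struct \<Rightarrow> bool" where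
  "emb_over K A f M N \<longleftrightarrow> (\<exists>M'. struct_iso (voc K) f M M' \<and> le K M' N) \<and> (\<forall>x\<in>A. f x = x)"

definition has_amalgamation :: "('s, 'a) aec \<Rightarrow> 'a rel \<Rightarrow> bool" where
  "has_amalgamation K l \<longleftrightarrow>
     (\<forall>M0\<in>K_at K l. \<forall>M1\<in>K_at K l. \<forall>M2\<in>K_at K l. le K M0 M1 \<and> le K M0 M2 \<longrightarrow>
        (\<exists>N\<in>K_at K l. \<exists>f g. emb_over K (univ M0) f M1 N \<and> emb_over K (univ M0) g M2 N))"

definition has_joint_embedding :: "('s, 'a) aec \<Rightarrow> 'a rel \<Rightarrow> bool" where
  "has_joint_embedding K l \<longleftrightarrow>
     (\<forall>M1\<in>K_at K l. \<forall>M2\<in>K_at K l.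
        \<exists>N\<in>K_at K l. \<exists>f g. emb_over K {} f M1 N \<and> emb_over K {} g M2 N)"

definition no_maximal_models :: "('s, 'a) aec \<Rightarrow> 'a rel \<Rightarrow> bool" where
  "no_maximal_models K l \<longleftrightarrow> (\<forall>M\<in>K_at K l. \<exists>N\<in>K_at K l. le K M N \<and> M \<noteq> N)"

section \<open>Galois types\<close>

text \<open>A Galois type is an equivalence class of triples \<open>(a, A, N)\<close> with \<open>a \<in> N\<close> and
  \<open>A \<subseteq> N\<close>, under the transitive closure of the relation \<open>E_at\<close> below.\<close>

type_synonym ('s, 'a) gtype = "('a \<times> 'a set \<times> ('s, 'a) struct) set"

definition E_at ::
    "('s, 'a) aec \<Rightarrow> (('a \<times> 'a set \<times> ('s, 'a) struct) \<times> ('a \<times> 'a set \<times> ('s, 'a) struct)) set" where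
  "E_at K = {((a, A, M), (b, B, N)).
     M \<in> mods K \<and> N \<in> mods K \<and> a \<in> univ M \<and> b \<in> univ N \<and> A = B \<and> A \<subseteq> univ M \<and> A \<subseteq> univ N \<and>
     (\<exists>P\<in>mods K. \<exists>f g. emb_over K A f M P \<and> emb_over K A g N P \<and> f a = g b)}"

definition gtp :: "('s, 'a) aec \<Rightarrow> 'a \<Rightarrow> 'a set \<Rightarrow> ('s, 'a) struct \<Rightarrow> ('s, 'a) gtype" where
  "gtp K a A N = (E_at K)\<^sup>+ `` {(a, A, N)}"

definition gS :: "('s, 'a) aec \<Rightarrow> ('s, 'a) struct \<Rightarrow> ('s, 'a) gtype set" where
  "gS K M = {gtp K a (univ M) N | a N. le K M N \<and> a \<in> univ N}"

text \<open>The members of the union are all equal when \<open>p\<close> is a type over a set containing \<open>A\<close>.\<close>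

definition gres :: "('s, 'a) aec \<Rightarrow> ('s, 'a) gtype \<Rightarrow> 'a set \<Rightarrow> ('s, 'a) gtype" where
  "gres K p A = (\<Union>(a, B, N)\<in>p. gtp K a A N)"

definition stable_in :: "('s, 'a) aec \<Rightarrow> 'a rel \<Rightarrow> bool" where
  "stable_in K l \<longleftrightarrow> (\<forall>M\<in>K_at K l. |gS K M| \<le>o l)"

text \<open>Models as large as the whole type are left out: they may have no proper extensions inside the
  type, and their Galois types here would not be those of an AEC living on all sets.\<close>

definition less_tame :: "('s, 'a) aec \<Rightarrow> 'c rel \<Rightarrow> bool" where
  "less_tame K t \<longleftrightarrow>
     (\<forall>M\<in>mods K. |univ M| <o |UNIV :: 'a set| \<longrightarrow>
        (\<forall>p\<in>gS K M. \<forall>q\<in>gS K M.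
           (\<forall>A. A \<subseteq> univ M \<and> |A| <o t \<longrightarrow> gres K p A = gres K q A) \<longrightarrow> p = q))"

definition tame :: "('s, 'a) aec \<Rightarrow> 'c rel \<Rightarrow> bool" where
  "tame K t \<longleftrightarrow> less_tame K (cardSuc t)"

section \<open>Universal extensions and limit models\<close>

definition le_u :: "('s, 'a) aec \<Rightarrow> 'a rel \<Rightarrow> ('s, 'a) struct \<Rightarrow> ('s, 'a) struct \<Rightarrow> bool" where
  "le_u K l M0 M \<longleftrightarrow> M0 \<in> K_at K l \<and> M \<in> K_at K l \<and> le K M0 M \<and>
     (\<forall>N\<in>K_at K l. le K M0 N \<longrightarrow> (\<exists>f. emb_over K (univ M0) f N M))"

text \<open>An \<open>R\<close>-increasing continuous chain \<open>\<langle>M i : i \<le> d\<rangle>\<close> in \<open>K_at K l\<close>, whose member with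
  index \<open>d\<close> is the separate argument \<open>Md\<close>.\<close>

definition cont_chain ::
    "('s, 'a) aec \<Rightarrow> 'a rel \<Rightarrow> (('s, 'a) struct \<Rightarrow> ('s, 'a) struct \<Rightarrow> bool) \<Rightarrow> 'a rel \<Rightarrow>
     ('a \<Rightarrow> ('s, 'a) struct) \<Rightarrow> ('s, 'a) struct \<Rightarrow> bool" where
  "cont_chain K l R d M Md \<longleftrightarrow>
     (\<forall>i\<in>Field d. M i \<in> K_at K l) \<and> Md \<in> K_at K l \<and>
     increasing R d M \<and> (\<forall>i\<in>Field d. R (M i) Md) \<and>
     (\<forall>j\<in>Field d. limit_ord (ord_of d j) \<longrightarrow> M j = union_struct (voc K) (underS d j) M) \<and>
     (limit_ord d \<longrightarrow> Md = union_struct (voc K) (Field d) M)"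

definition limit_model :: "('s, 'a) aec \<Rightarrow> 'a rel \<Rightarrow> 'a rel \<Rightarrow> ('s, 'a) struct \<Rightarrow> bool" where
  "limit_model K l d N \<longleftrightarrow> limit_ord d \<and> d <o cardSuc l \<and>
     (\<exists>M. cont_chain K l (le K) d M N \<and> (\<forall>i\<in>Field d. le_u K l (M i) (M (ord_suc d i))))"

section \<open>Independence relations\<close>

text \<open>\<open>I M0 a M N\<close> is read: \<open>a\<close> is independent from \<open>M\<close> over \<open>M0\<close> in \<open>N\<close>.\<close>

type_synonym ('s, 'a) indep = "('s, 'a) struct \<Rightarrow> 'a \<Rightarrow> ('s, 'a) struct \<Rightarrow> ('s, 'a) struct \<Rightarrow> bool"

definition independence_relation :: "('s, 'a) aec \<Rightarrow> 'a rel \<Rightarrow> ('s, 'a) indep \<Rightarrow> bool" where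
  "independence_relation K l I \<longleftrightarrow>
     (\<forall>M0 a M N. I M0 a M N \<longrightarrow>
        M0 \<in> K_at K l \<and> M \<in> K_at K l \<and> N \<in> K_at K l \<and> le K M0 M \<and> le K M N \<and> a \<in> univ N) \<and>
     \<comment> \<open>invariance\<close>
     (\<forall>f M0 a M N M0' M' N'. I M0 a M N \<and> struct_iso (voc K) f N N' \<and> struct_iso (voc K) f M M' \<and>
        struct_iso (voc K) f M0 M0' \<longrightarrow> I M0' (f a) M' N') \<and>
     \<comment> \<open>monotonicity\<close>
     (\<forall>M0 a M N M1. I M0 a M N \<and> le K M0 M1 \<and> le K M1 M \<longrightarrow> I M0 a M1 N) \<and>
     (\<forall>M0 a M N N'. I M0 a M N \<and> le K M N' \<and> le K N' N \<and> a \<in> univ N' \<longrightarrow> I M0 a M N') \<and>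
     (\<forall>M0 a M N N'. I M0 a M N \<and> le K N N' \<and> N' \<in> K_at K l \<longrightarrow> I M0 a M N') \<and>
     \<comment> \<open>base monotonicity\<close>
     (\<forall>M0 a M N M1. I M0 a M N \<and> le K M0 M1 \<and> le K M1 M \<longrightarrow> I M1 a M N)"

text \<open>\<open>p \<in> gS K M\<close> does not \<open>I\<close>-fork over \<open>M0\<close>.\<close>

definition nonfork ::
    "('s, 'a) aec \<Rightarrow> ('s, 'a) indep \<Rightarrow> ('s, 'a) gtype \<Rightarrow> ('s, 'a) struct \<Rightarrow> ('s, 'a) struct \<Rightarrow> bool" where
  "nonfork K I p M M0 \<longleftrightarrow> (\<exists>a N. p = gtp K a (univ M) N \<and> I M0 a M N)"

definition has_uniqueness :: "('s, 'a) aec \<Rightarrow> 'a rel \<Rightarrow> ('s, 'a) indep \<Rightarrow> bool" where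
  "has_uniqueness K l I \<longleftrightarrow>
     (\<forall>M\<in>K_at K l. \<forall>N\<in>K_at K l. le K M N \<longrightarrow>
        (\<forall>p\<in>gS K N. \<forall>q\<in>gS K N. nonfork K I p N M \<and> nonfork K I q N M \<and>
           gres K p (univ M) = gres K q (univ M) \<longrightarrow> p = q))"

definition has_extension :: "('s, 'a) aec \<Rightarrow> 'a rel \<Rightarrow> ('s, 'a) indep \<Rightarrow> bool" where
  "has_extension K l I \<longleftrightarrow>
     (\<forall>M0\<in>K_at K l. \<forall>M\<in>K_at K l. \<forall>N\<in>K_at K l. le K M0 M \<and> le K M N \<longrightarrow>
        (\<forall>p\<in>gS K M. nonfork K I p M M0 \<longrightarrow>
           (\<exists>q\<in>gS K N. gres K q (univ M) = p \<and> nonfork K I q N M0)))"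

text \<open>A \<open>\<le>\<^sup>u\<close>-increasing (not necessarily continuous) chain of length \<open>g\<close> in \<open>K_at K l\<close> with
  union \<open>Mg\<close> in \<open>K_at K l\<close>.\<close>

definition u_chain ::
    "('s, 'a) aec \<Rightarrow> 'a rel \<Rightarrow> 'a rel \<Rightarrow> ('a \<Rightarrow> ('s, 'a) struct) \<Rightarrow> ('s, 'a) struct \<Rightarrow> bool" where
  "u_chain K l g M Mg \<longleftrightarrow> (\<forall>i\<in>Field g. M i \<in> K_at K l) \<and> increasing (le_u K l) g M \<and>
     Mg = union_struct (voc K) (Field g) M \<and> Mg \<in> K_at K l"

definition local_character :: "('s, 'a) aec \<Rightarrow> 'a rel \<Rightarrow> ('s, 'a) indep \<Rightarrow> 'a rel \<Rightarrow> bool" where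
  "local_character K l I g \<longleftrightarrow>
     (\<forall>M Mg. u_chain K l g M Mg \<longrightarrow> (\<forall>p\<in>gS K Mg. \<exists>i\<in>Field g. nonfork K I p Mg (M i)))"

definition univ_continuity_at :: "('s, 'a) aec \<Rightarrow> 'a rel \<Rightarrow> ('s, 'a) indep \<Rightarrow> 'a rel \<Rightarrow> bool" where
  "univ_continuity_at K l I g \<longleftrightarrow>
     (\<forall>M Mg. u_chain K l g M Mg \<longrightarrow>
        (\<forall>p\<in>gS K Mg.
           (\<forall>i\<in>Field g. nonfork K I (gres K p (univ (M i))) (M i) (M (ord_zero g))) \<longrightarrow>
           nonfork K I p Mg (M (ord_zero g))))"

definition geq_local_character :: "('s, 'a) aec \<Rightarrow> 'a rel \<Rightarrow> ('s, 'a) indep \<Rightarrow> 'a rel \<Rightarrow> bool" where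
  "geq_local_character K l I k \<longleftrightarrow> (\<forall>g. regular_cardinal g \<and> k \<le>o g \<longrightarrow> local_character K l I g)"

definition universal_continuity :: "('s, 'a) aec \<Rightarrow> 'a rel \<Rightarrow> ('s, 'a) indep \<Rightarrow> bool" where
  "universal_continuity K l I \<longleftrightarrow> (\<forall>g. regular_cardinal g \<longrightarrow> univ_continuity_at K l I g)"

section \<open>The local character cardinal\<close>

definition kappa_set :: "('s, 'a) aec \<Rightarrow> 'a rel \<Rightarrow> ('s, 'a) indep \<Rightarrow> 'a rel set" where
  "kappa_set K l I = {d. Well_order d \<and> d <o cardSuc l \<and>
     (\<forall>M Md. cont_chain K l (le_u K l) d M Md \<longrightarrow>
        (\<forall>p\<in>gS K Md. \<exists>i\<in>Field d. nonfork K I p Md (M i)))}"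

definition kappa_bound :: "('s, 'a) aec \<Rightarrow> 'a rel \<Rightarrow> ('s, 'a) indep \<Rightarrow> 'a rel \<Rightarrow> bool" where
  "kappa_bound K l I m \<longleftrightarrow> Card_order m \<and> m \<le>o l \<and>
     (\<forall>g. regular_cardinal g \<and> m \<le>o g \<and> g <o cardSuc l \<longrightarrow> g \<in> kappa_set K l I)"

text \<open>\<^const>\<open>None\<close> stands for \<open>\<infinity>\<close>.\<close>

definition kappa :: "('s, 'a) aec \<Rightarrow> 'a rel \<Rightarrow> ('s, 'a) indep \<Rightarrow> 'a rel option" where
  "kappa K l I =
     (if \<exists>m. kappa_bound K l I m
      then Some (SOME m. kappa_bound K l I m \<and> (\<forall>n. kappa_bound K l I n \<longrightarrow> m \<le>o n))
      else None)"

definition less_inf :: "'a rel \<Rightarrow> 'a rel option \<Rightarrow> bool" where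
  "less_inf c k \<longleftrightarrow> (case k of None \<Rightarrow> True | Some m \<Rightarrow> c <o m)"

end

(* By universal continuity, a regular cardinal below the local character cardinal carries a universal
   chain with a type over its union that forks over every member, and the chain can be thinned to any
   smaller regular length. Hence we may assume mu = cf d1 < cf d2, exchanging d1 and d2 if necessary.
   Let p be such a type over the union M of a chain of length mu. Uniqueness and extension, applied to a
   (lambda,kappa)-limit model between consecutive members, turn forking of p into splitting, and by
   tameness a splitting over M_i is witnessed by a countable subset of M: no element of M_i realizes
   the restriction of p to it. The union B of these mu countable sets has size at most mu, and no
   element of M realizes p on B. By uniqueness of limit models of the same cofinality, if the two
   limit models were isomorphic then M would also be the union of a chain of length d2; some member
   of it contains B and the next member realizes p on B. *)

theory Submission
  imports Defs
begin

section \<open>Well-orders and cofinality\<close>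

text \<open>Forking is an abstract relation and carries no small witness, while tameness only
  separates two given types. Splitting supplies such a pair: a type and its image under an
  isomorphism of a model onto a submodel. An element fixed by this isomorphism cannot satisfy both,
  which is why realizations inside an early member are excluded. Local character is available only
  along sufficiently long chains, whereas the forking chain may be shorter; hence the limit models
  of length \<open>\<kappa>\<close> between its members. Amalgamation is assumed only in cardinality
  \<open>lam\<close>, but a type may be realized in a model of any size. Equality of types is
  therefore a finite sequence of \<open>E_at\<close> links, and restriction and transport of types
  follow that sequence. Renaming inside the fixed type \<open>'a\<close> succeeds because the part
  sent to prescribed places always has fewer than \<open>|UNIV|\<close> elements. Universal
  extensions of arbitrary models are derived from the forking chain by joint embedding.\<close>

lemma Well_order_total:
  assumes "Well_order d" "a \<in> Field d" "b \<in> Field d"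
  shows "(a, b) \<in> d \<or> (b, a) \<in> d"
proof -
  interpret wo_rel d using assms(1) by (simp add: wo_rel_def)
  show ?thesis using assms TOTALS by blast
qed

lemma Well_order_antisym:
  "Well_order d \<Longrightarrow> (a, b) \<in> d \<Longrightarrow> (b, a) \<in> d \<Longrightarrow> a = b"
  by (auto simp: order_on_defs antisym_def)

lemma Well_order_trans:
  "Well_order d \<Longrightarrow> (a, b) \<in> d \<Longrightarrow> (b, c) \<in> d \<Longrightarrow> (a, c) \<in> d"
  by (auto simp: order_on_defs trans_def)

lemma Well_order_refl:
  "Well_order d \<Longrightarrow> a \<in> Field d \<Longrightarrow> (a, a) \<in> d"
  by (auto simp: order_on_defs refl_on_def)

lemma ord_suc_props:
  assumes "limit_ord d" "i \<in> Field d"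
  shows "ord_suc d i \<in> Field d" "(i, ord_suc d i) \<in> d" "i \<noteq> ord_suc d i"
    "\<And>k. (i, k) \<in> d \<Longrightarrow> i \<noteq> k \<Longrightarrow> (ord_suc d i, k) \<in> d"
proof -
  interpret wo_rel d using assms(1) by (simp add: wo_rel_def limit_ord_def)
  have "AboveS {i} \<noteq> {}"
    using assms unfolding limit_ord_def cofinal_def AboveS_def by (auto simp: Field_def)
  then show "ord_suc d i \<in> Field d" "(i, ord_suc d i) \<in> d" "i \<noteq> ord_suc d i"
    unfolding ord_suc_def using suc_greater[of "{i}" i] suc_inField[of "{i}"] assms(2) by auto
  fix k assume "(i, k) \<in> d" "i \<noteq> k"
  then show "(ord_suc d i, k) \<in> d"
    unfolding ord_suc_def by (intro suc_least_AboveS) (auto simp: AboveS_def Field_def)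
qed

lemma ord_zero_props:
  assumes "Well_order d" "Field d \<noteq> {}"
  shows "ord_zero d \<in> Field d" "\<And>k. k \<in> Field d \<Longrightarrow> (ord_zero d, k) \<in> d"
proof -
  interpret wo_rel d using assms(1) by (simp add: wo_rel_def)
  show "ord_zero d \<in> Field d" "\<And>k. k \<in> Field d \<Longrightarrow> (ord_zero d, k) \<in> d"
    unfolding ord_zero_def using assms minim_in minim_least by auto
qed

lemma Cinfinite_limit_ord:
  assumes "Cinfinite r" shows "limit_ord r"
proof -
  have "Card_order r" "\<not> finite (Field r)" using assms by (auto simp: cinfinite_def)
  then show ?thesis unfolding limit_ord_def cofinal_def
    using infinite_Card_order_limit[of r] by (auto simp: card_order_on_def)
qed

lemma regular_cardinal_limit_ord: "regular_cardinal g \<Longrightarrow> limit_ord g"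
  by (simp add: regular_cardinal_def Cinfinite_limit_ord)

section \<open>Recursive choices along a well-order\<close>

lemma wf_strict: "Well_order d \<Longrightarrow> wf (d - Id)"
  by (simp add: well_order_on_def)

text \<open>The transfinite constructions below go through this scheme. By \<open>adm\<close>,
  \<open>P j f\<close> looks at \<open>f\<close> only below \<open>j\<close>, which makes
  \<open>dependent_wf_choice\<close> applicable; \<open>ex\<close> may use that all earlier values
  satisfy their own \<open>P\<close>.\<close>

lemma transfinite_choice:
  fixes P :: "'a \<Rightarrow> ('a \<Rightarrow> 'b) \<Rightarrow> 'b \<Rightarrow> bool"
  assumes "Well_order d"
    and adm: "\<And>j f g x. (\<And>i. i \<in> underS d j \<Longrightarrow> f i = g i) \<Longrightarrow> P j f x \<Longrightarrow> P j g x"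
    and ex: "\<And>j f. j \<in> Field d \<Longrightarrow> (\<And>i. i \<in> underS d j \<Longrightarrow> P i f (f i)) \<Longrightarrow> \<exists>x. P j f x"
  shows "\<exists>f. \<forall>j\<in>Field d. P j f (f j)"
proof -
  have "\<exists>f. \<forall>j. j \<in> Field d \<longrightarrow> P j f (f j)"
  proof (rule dependent_wf_choice[OF wf_strict[OF assms(1)]])
    fix f g :: "'a \<Rightarrow> 'b" and j x
    assume *: "\<And>z. (z, j) \<in> d - Id \<Longrightarrow> f z = g z"
    then have "\<And>i. i \<in> underS d j \<Longrightarrow> f i = g i" by (simp add: underS_def)
    then show "(j \<in> Field d \<longrightarrow> P j f x) = (j \<in> Field d \<longrightarrow> P j g x)"
      using adm[of j f g x] adm[of j g f x] by auto
  next
    fix j f assume "\<And>y. (y, j) \<in> d - Id \<Longrightarrow> y \<in> Field d \<longrightarrow> P y f (f y)"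
    then show "\<exists>r. j \<in> Field d \<longrightarrow> P j f r"
      using ex[of j f] by (auto simp: underS_def Field_def)
  qed
  then show ?thesis by blast
qed

lemma not_cofinal_bound:
  assumes "Well_order e" "S \<subseteq> Field e" "\<not> cofinal S e"
  obtains b where "b \<in> Field e" "\<And>s. s \<in> S \<Longrightarrow> (s, b) \<in> e"
proof -
  obtain b where b: "b \<in> Field e" "\<forall>s\<in>S. b = s \<or> (b, s) \<notin> e"
    using assms(3) unfolding cofinal_def by blast
  have "(s, b) \<in> e" if "s \<in> S" for s
  proof (cases "b = s")
    case False
    then show ?thesis using b that Well_order_total[OF assms(1), of s b] assms(2) by auto
  qed (use Well_order_refl[OF assms(1) b(1)] in simp)
  with b(1) show ?thesis by (rule that)
qed

text \<open>One recursion for all reindexings. \<open>G\<close> bounds \<open>h\<close> from below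
  and fixes its value at the least index, \<open>F\<close> prescribes how far each step must jump,
  and \<open>nc\<close> keeps the earlier values bounded, since there are at most
  \<open>|underS d j|\<close> of them.\<close>

lemma increasing_choice:
  assumes d: "Well_order d" and e: "limit_ord e"
    and nc: "\<And>j S. j \<in> Field d \<Longrightarrow> S \<subseteq> Field e \<Longrightarrow> |S| \<le>o |underS d j| \<Longrightarrow> \<not> cofinal S e"
    and G: "\<And>j. j \<in> Field d \<Longrightarrow> G j \<in> Field e"
    and F: "\<And>i. i \<in> Field e \<Longrightarrow> F i \<in> Field e"
  obtains h where "\<And>j. j \<in> Field d \<Longrightarrow> h j \<in> Field e"
    "\<And>j. j \<in> Field d \<Longrightarrow> underS d j = {} \<Longrightarrow> h j = G j"
    "\<And>j. j \<in> Field d \<Longrightarrow> (G j, h j) \<in> e"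
    "\<And>i j. (i, j) \<in> d \<Longrightarrow> i \<noteq> j \<Longrightarrow> (F (h i), h j) \<in> e \<and> (h i, h j) \<in> e \<and> h i \<noteq> h j"
proof -
  have we: "Well_order e" using e by (simp add: limit_ord_def)
  let ?P = "\<lambda>j h x. x \<in> Field e \<and> (underS d j = {} \<longrightarrow> x = G j) \<and> (G j, x) \<in> e \<and>
     (\<forall>i\<in>underS d j. (F (h i), x) \<in> e \<and> (h i, x) \<in> e \<and> h i \<noteq> x)"
  have "\<exists>h. \<forall>j\<in>Field d. ?P j h (h j)"
  proof (rule transfinite_choice[OF d])
    fix j and f g :: "'a \<Rightarrow> 'b" and x
    assume "\<And>i. i \<in> underS d j \<Longrightarrow> f i = g i" "?P j f x"
    then show "?P j g x" by simp
  next
    fix j h assume j: "j \<in> Field d" and IH: "\<And>i. i \<in> underS d j \<Longrightarrow> ?P i h (h i)"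
    show "\<exists>x. ?P j h x"
    proof (cases "underS d j = {}")
      case True
      then show ?thesis using G[OF j] Well_order_refl[OF we] by auto
    next
      case False
      let ?S1 = "(\<lambda>i. F (h i)) ` underS d j" and ?S2 = "h ` underS d j"
      have s: "?S1 \<subseteq> Field e" "?S2 \<subseteq> Field e" using IH F by auto
      obtain b1 where b1: "b1 \<in> Field e" "\<And>s. s \<in> ?S1 \<Longrightarrow> (s, b1) \<in> e"
        using not_cofinal_bound[OF we s(1) nc[OF j s(1)]] by (auto simp: card_of_image)
      obtain b2 where b2: "b2 \<in> Field e" "\<And>s. s \<in> ?S2 \<Longrightarrow> (s, b2) \<in> e"
        using not_cofinal_bound[OF we s(2) nc[OF j s(2)]] by (auto simp: card_of_image)
      obtain b3 where b3: "b3 \<in> Field e" "(b1, b3) \<in> e" "(b2, b3) \<in> e"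
        using Well_order_total[OF we b1(1) b2(1)] Well_order_refl[OF we] b1 b2 by blast
      obtain b4 where b4: "b4 \<in> Field e" "(b3, b4) \<in> e" "(G j, b4) \<in> e"
        using Well_order_total[OF we b3(1) G[OF j]] Well_order_refl[OF we] b3 G[OF j] by blast
      \<comment> \<open>\<open>b4\<close> bounds the earlier values only weakly; its successor makes
        \<open>h\<close> strictly increasing.\<close>
      let ?x = "ord_suc e b4"
      note su = ord_suc_props[OF e b4(1)]
      have 1: "(F (h i), ?x) \<in> e" if "i \<in> underS d j" for i
        using that b1(2) b3 b4 su Well_order_trans[OF we] by (meson imageI)
      have 2: "(h i, b4) \<in> e" if "i \<in> underS d j" for i
        using that b2(2) b3 b4 Well_order_trans[OF we] by (meson imageI)
      have "(h i, ?x) \<in> e \<and> h i \<noteq> ?x" if "i \<in> underS d j" for i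
        using 2[OF that] su Well_order_trans[OF we] Well_order_antisym[OF we] by metis
      moreover have "(G j, ?x) \<in> e" using b4 su Well_order_trans[OF we] by metis
      ultimately show ?thesis using 1 su False by blast
    qed
  qed
  then obtain h where h: "\<And>j. j \<in> Field d \<Longrightarrow> ?P j h (h j)" by blast
  show ?thesis
  proof (rule that[of h])
    fix i j assume "(i, j) \<in> d" "i \<noteq> j"
    then show "(F (h i), h j) \<in> e \<and> (h i, h j) \<in> e \<and> h i \<noteq> h j"
      using h[of j] by (auto simp: underS_def Field_def)
  qed (use h in blast)+
qed

section \<open>Cofinalities as regular cardinals\<close>

lemma cf_obtain:
  assumes "limit_ord d"
  obtains A where "cf d = |A|" "A \<subseteq> Field d" "cofinal A d"
    "\<And>B. B \<subseteq> Field d \<Longrightarrow> cofinal B d \<Longrightarrow> |A| \<le>o |B|"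
proof -
  let ?P = "\<lambda>A. A \<subseteq> Field d \<and> cofinal A d \<and> (\<forall>B. B \<subseteq> Field d \<and> cofinal B d \<longrightarrow> |A| \<le>o |B| )"
  let ?R = "{|A| | A. A \<subseteq> Field d \<and> cofinal A d}"
  have "?R \<noteq> {}" using assms by (auto simp: limit_ord_def)
  moreover have "\<forall>r\<in>?R. Card_order r" by (auto simp: card_of_Card_order)
  ultimately obtain r where "r \<in> ?R" "\<forall>r'\<in>?R. r \<le>o r'" using exists_minim_Card_order[of ?R] by blast
  then have "\<exists>A. ?P A" by blast
  then have "?P (SOME A. ?P A)" by (rule someI_ex)
  then show ?thesis using that[of "SOME A. ?P A"] unfolding cf_def by blast
qed

lemma cf_not_cofinal:
  assumes "limit_ord d" "S \<subseteq> Field d" "|S| <o cf d"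
  shows "\<not> cofinal S d"
  using cf_obtain[OF assms(1)] assms(2,3) by (metis not_ordLess_ordLeq)

lemma finite_not_cofinal:
  assumes d: "Well_order d" "finite S" "S \<subseteq> Field d" "Field d \<noteq> {}"
  shows "\<not> cofinal S d"
proof -
  have "\<exists>b\<in>Field d. \<forall>s\<in>S. (s, b) \<in> d" using assms(2,3)
  proof (induction S)
    case (insert x S)
    then obtain b where b: "b \<in> Field d" "\<forall>s\<in>S. (s, b) \<in> d" by auto
    then show ?case using insert.prems Well_order_total[OF d(1), of x b] Well_order_refl[OF d(1)]
        Well_order_trans[OF d(1)] by (metis insert_iff insert_subset)
  qed (use d in auto)
  then show ?thesis unfolding cofinal_def using Well_order_antisym[OF d(1)] by blast
qed

text \<open>Order a cofinal set \<open>A\<close> of least size in type \<open>|A|\<close>. If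
  \<open>K\<close> were cofinal there and smaller than \<open>A\<close>, each initial segment of
  \<open>A\<close> below a member of \<open>K\<close> would be bounded in \<open>d\<close>, and
  these fewer than \<open>|A|\<close> bounds would be cofinal in \<open>d\<close>.\<close>

lemma cf_regular:
  assumes d: "limit_ord d"
  shows "regular_cardinal (cf d)"
proof -
  have wd: "Well_order d" and ne: "Field d \<noteq> {}" using d by (auto simp: limit_ord_def)
  obtain A where A: "cf d = |A|" "A \<subseteq> Field d" "cofinal A d"
    and min: "\<And>B. B \<subseteq> Field d \<Longrightarrow> cofinal B d \<Longrightarrow> |A| \<le>o |B|" using cf_obtain[OF d] by blast
  have inf: "infinite A" using finite_not_cofinal[OF wd _ A(2) ne] A(3) by blast
  have "|K| =o |A|" if K: "K \<subseteq> A" "cofinal K |A|" for K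
  proof (rule ccontr)
    assume "\<not> |K| =o |A|"
    then have KA: "|K| <o |A|" using card_of_mono1[OF K(1)] by (simp add: ordLeq_iff_ordLess_or_ordIso)
    have "\<exists>b\<in>Field d. \<forall>s\<in>underS |A| k. (s, b) \<in> d" if "k \<in> K" for k
    proof -
      have "underS |A| k \<subseteq> Field d" using A(2) FieldI1[of _ k "|A|"] by (auto simp: underS_def Field_card_of)
      moreover have "\<not> cofinal (underS |A| k) d"
        using min[OF calculation] card_of_underS[OF card_of_Card_order[of A], of k] subsetD[OF K(1) that]
          not_ordLess_ordLeq by (auto simp: Field_card_of)
      ultimately show ?thesis by (rule not_cofinal_bound[OF wd]) blast
    qed
    then obtain b where b: "\<And>k. k \<in> K \<Longrightarrow> b k \<in> Field d"
      "\<And>k s. k \<in> K \<Longrightarrow> s \<in> underS |A| k \<Longrightarrow> (s, b k) \<in> d" by metis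
    have "cofinal (b ` K) d" unfolding cofinal_def
    proof
      fix a assume "a \<in> Field d"
      then obtain a' where a': "a' \<in> A" "a \<noteq> a'" "(a, a') \<in> d" using A(3) unfolding cofinal_def by blast
      then obtain k where "k \<in> K" "a' \<in> underS |A| k"
        using K(2) unfolding cofinal_def underS_def Field_card_of by blast
      with b have "(a', b k) \<in> d" "b k \<in> b ` K" by auto
      then show "\<exists>c\<in>b ` K. a \<noteq> c \<and> (a, c) \<in> d"
        using a' Well_order_trans[OF wd] Well_order_antisym[OF wd] by metis
    qed
    then have "|A| \<le>o |b ` K|" using min[of "b ` K"] b(1) by blast
    then show False using KA card_of_image[of b K] by (meson not_ordLess_ordLeq ordLeq_transitive)
  qed
  then show ?thesis unfolding regular_cardinal_def regularCard_def A(1)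
    using inf by (simp add: cinfinite_def card_of_card_order_on Field_card_of)
qed

lemma regular_not_cofinal:
  assumes "regular_cardinal g" "S \<subseteq> Field g" "|S| <o g"
  shows "\<not> cofinal S g"
  using assms unfolding regular_cardinal_def regularCard_def using not_ordLess_ordIso by blast

lemma cf_leq:
  assumes "limit_ord d" "Card_order l" "d <o cardSuc l"
  shows "cf d \<le>o l" "|Field d| \<le>o l"
proof -
  have "|Field d| \<le>o d" using assms(1) by (simp add: limit_ord_def card_of_least well_order_on_Field)
  then have "|Field d| <o cardSuc l" using assms(3) ordLeq_ordLess_trans by blast
  then show "|Field d| \<le>o l" using assms(2) cardSuc_ordLeq_ordLess[of l "|Field d|"]
    by (simp add: card_of_Card_order)
  moreover obtain A where "cf d = |A|" "A \<subseteq> Field d" by (rule cf_obtain[OF assms(1)])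
  ultimately show "cf d \<le>o l" by (metis card_of_mono1 ordLeq_transitive)
qed

text \<open>\<open>cf d\<close> orders a cofinal set \<open>A\<close> without regard to
  \<open>d\<close>, so the inclusion of \<open>A\<close> need not be monotone. The recursion keeps
  \<open>h j\<close> above \<open>j\<close> itself, which preserves cofinality.\<close>

lemma cofinal_sequence:
  assumes "limit_ord d"
  obtains c where "\<And>j. j \<in> Field (cf d) \<Longrightarrow> c j \<in> Field d"
    "\<And>i j. (i, j) \<in> cf d \<Longrightarrow> i \<noteq> j \<Longrightarrow> (c i, c j) \<in> d \<and> c i \<noteq> c j"
    "\<And>x. x \<in> Field d \<Longrightarrow> \<exists>j\<in>Field (cf d). (x, c j) \<in> d"
proof -
  have wd: "Well_order d" using assms by (simp add: limit_ord_def)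
  obtain A where A: "cf d = |A|" "A \<subseteq> Field d" "cofinal A d" by (rule cf_obtain[OF assms])
  have f: "Field (cf d) = A" by (simp add: A Field_card_of)
  have r: "Card_order (cf d)" by (simp add: A card_of_Card_order)
  obtain h where h: "\<And>j. j \<in> Field (cf d) \<Longrightarrow> h j \<in> Field d"
    "\<And>j. j \<in> Field (cf d) \<Longrightarrow> (j, h j) \<in> d"
    "\<And>i j. (i, j) \<in> cf d \<Longrightarrow> i \<noteq> j \<Longrightarrow> (h i, h j) \<in> d \<and> h i \<noteq> h j"
  proof (rule increasing_choice[of "cf d" d id id])
    show "Well_order (cf d)" using r by (simp add: card_order_on_def)
    show "\<not> cofinal S d" if "j \<in> Field (cf d)" "S \<subseteq> Field d" "|S| \<le>o |underS (cf d) j|" for j S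
      using cf_not_cofinal[OF assms that(2)] that(3) card_of_underS[OF r that(1)]
      by (meson ordLeq_ordLess_trans)
  qed (use f A assms in auto)
  show ?thesis
  proof (rule that[of h])
    fix x assume "x \<in> Field d"
    then obtain a where "a \<in> A" "(x, a) \<in> d" using A(3) unfolding cofinal_def by blast
    then show "\<exists>j\<in>Field (cf d). (x, h j) \<in> d" using h(2) f Well_order_trans[OF wd] by blast
  qed (use h in auto)
qed

section \<open>Isomorphisms and embeddings\<close>

lemma args_map: "xs \<in> args V s A \<Longrightarrow> f ` A \<subseteq> B \<Longrightarrow> map f xs \<in> args V s B"
  by (auto simp: args_def)

lemma is_struct_fn: "is_struct V M \<Longrightarrow> s \<in> Funs V \<Longrightarrow> xs \<in> args V s (univ M) \<Longrightarrow> fn M s xs \<in> univ M"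
  unfolding is_struct_def by metis

lemma is_struct_rl: "is_struct V M \<Longrightarrow> s \<in> Rels V \<Longrightarrow> rl M s \<subseteq> args V s (univ M)"
  unfolding is_struct_def by metis

lemma is_struct_rl_empty: "is_struct V M \<Longrightarrow> s \<notin> Rels V \<Longrightarrow> rl M s = {}"
  unfolding is_struct_def by metis

lemma struct_isoD:
  assumes "struct_iso V f M N"
  shows "is_struct V M" "is_struct V N" "bij_betw f (univ M) (univ N)" "inj_on f (univ M)"
    "f ` univ M = univ N"
    "\<And>s xs. s \<in> Funs V \<Longrightarrow> xs \<in> args V s (univ M) \<Longrightarrow> fn N s (map f xs) = f (fn M s xs)"
    "\<And>s xs. s \<in> Rels V \<Longrightarrow> xs \<in> args V s (univ M) \<Longrightarrow> map f xs \<in> rl N s \<longleftrightarrow> xs \<in> rl M s"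
  using assms unfolding struct_iso_def bij_betw_def by auto

lemma struct_iso_cong:
  assumes "struct_iso V f M N" "\<And>x. x \<in> univ M \<Longrightarrow> f x = g x"
  shows "struct_iso V g M N"
proof -
  have m: "map f xs = map g xs" if "xs \<in> args V s (univ M)" for s xs
    using that assms(2) by (auto simp: args_def)
  have "bij_betw g (univ M) (univ N)"
    using assms(1) bij_betw_cong[of "univ M" f g] assms(2) by (auto simp: struct_iso_def)
  then show ?thesis using assms m is_struct_fn[of V M] unfolding struct_iso_def by metis
qed

lemma struct_iso_id: "is_struct V M \<Longrightarrow> struct_iso V (\<lambda>x. x) M M"
  unfolding struct_iso_def by (auto simp: bij_betw_def)

lemma struct_iso_comp:
  assumes f: "struct_iso V f M N" and g: "struct_iso V g N P"
  shows "struct_iso V (\<lambda>x. g (f x)) M P"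
proof -
  have a: "map f xs \<in> args V s (univ N)" if "xs \<in> args V s (univ M)" for s xs
    by (rule args_map[OF that]) (simp add: struct_isoD(5)[OF f])
  have "bij_betw (\<lambda>x. g (f x)) (univ M) (univ P)"
    using bij_betw_trans[OF struct_isoD(3)[OF f] struct_isoD(3)[OF g]] by (simp add: comp_def)
  moreover have "g (f (fn M s xs)) = fn P s (map (\<lambda>x. g (f x)) xs)"
    if "s \<in> Funs V" "xs \<in> args V s (univ M)" for s xs
    using struct_isoD(6)[OF f that] struct_isoD(6)[OF g that(1) a[OF that(2)]] by (simp add: comp_def)
  moreover have "xs \<in> rl M s \<longleftrightarrow> map (\<lambda>x. g (f x)) xs \<in> rl P s"
    if "s \<in> Rels V" "xs \<in> args V s (univ M)" for s xs
    using struct_isoD(7)[OF f that] struct_isoD(7)[OF g that(1) a[OF that(2)]] by (simp add: comp_def)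
  ultimately show ?thesis using f g by (auto simp: struct_iso_def)
qed

lemma struct_iso_inv:
  assumes f: "struct_iso V f M N"
  shows "\<exists>g. struct_iso V g N M \<and> (\<forall>x\<in>univ M. g (f x) = x) \<and> (\<forall>y\<in>univ N. f (g y) = y)"
proof -
  let ?g = "inv_into (univ M) f"
  have gf: "?g (f x) = x" if "x \<in> univ M" for x using struct_isoD(4)[OF f] that by simp
  have fg: "f (?g y) = y" if "y \<in> univ N" for y
    using struct_isoD(5)[OF f] that by (simp add: f_inv_into_f)
  have b: "bij_betw ?g (univ N) (univ M)" using struct_isoD(3)[OF f] by (rule bij_betw_inv_into)
  have a: "map ?g ys \<in> args V s (univ M) \<and> map f (map ?g ys) = ys" if "ys \<in> args V s (univ N)" for s ys
    using that args_map[OF that, of ?g "univ M"] b fg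
    by (auto simp: bij_betw_def args_def intro!: map_idI)
  have "?g (fn N s ys) = fn M s (map ?g ys)" if "s \<in> Funs V" "ys \<in> args V s (univ N)" for s ys
    using a[OF that(2)] struct_isoD(6)[OF f that(1), of "map ?g ys"]
      gf[OF is_struct_fn[OF struct_isoD(1)[OF f] that(1), of "map ?g ys"]] by metis
  moreover have "ys \<in> rl N s \<longleftrightarrow> map ?g ys \<in> rl M s" if "s \<in> Rels V" "ys \<in> args V s (univ N)" for s ys
    using a[OF that(2)] struct_isoD(7)[OF f that(1), of "map ?g ys"] by metis
  ultimately have "struct_iso V ?g N M" using f b by (auto simp: struct_iso_def)
  then show ?thesis using gf fg by blast
qed

lemma struct_iso_image:
  fixes M :: "('s, 'a) struct"
  assumes M: "is_struct V M" and f: "inj_on f (univ M)"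
  shows "\<exists>N. struct_iso V f M N"
proof -
  let ?g = "inv_into (univ M) f"
  let ?N = "\<lparr>univ = f ` univ M,
     fn = (\<lambda>s ys. if s \<in> Funs V \<and> ys \<in> args V s (f ` univ M) then f (fn M s (map ?g ys)) else undefined),
     rl = (\<lambda>s. map f ` rl M s)\<rparr>"
  have g: "map ?g ys \<in> args V s (univ M)" if "ys \<in> args V s (f ` univ M)" for s ys
    using args_map[OF that, of ?g "univ M"] by (simp add: image_subset_iff inv_into_into)
  have gf: "map ?g (map f xs) = xs" if "xs \<in> args V s (univ M)" for s xs
    using that f by (auto simp: args_def intro!: map_idI)
  have fxs: "map f xs \<in> args V s (f ` univ M)" if "xs \<in> args V s (univ M)" for s xs
    using args_map[OF that] by blast
  have "map f ` rl M s \<subseteq> args V s (f ` univ M)" if "s \<in> Rels V" for s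
    using is_struct_rl[OF M that] fxs by auto
  then have "is_struct V ?N"
    unfolding is_struct_def using g is_struct_fn[OF M] is_struct_rl_empty[OF M] by simp
  moreover have "xs \<in> rl M s \<longleftrightarrow> map f xs \<in> map f ` rl M s"
    if "s \<in> Rels V" "xs \<in> args V s (univ M)" for s xs
    using gf[of _ s] is_struct_rl[OF M that(1)] that(2)
    by (metis (no_types, lifting) imageE imageI subsetD)
  ultimately have "struct_iso V f M ?N"
    using M f fxs gf by (auto simp: struct_iso_def bij_betw_def)
  then show ?thesis by blast
qed

lemma isomorphic_sym: "isomorphic V M N \<Longrightarrow> isomorphic V N M"
  unfolding isomorphic_def by (metis struct_iso_inv)

lemma isomorphic_trans: "isomorphic V M N \<Longrightarrow> isomorphic V N P \<Longrightarrow> isomorphic V M P"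
  unfolding isomorphic_def by (metis struct_iso_comp)

section \<open>Unions of chains and room for renaming\<close>

lemma substructD:
  assumes "substruct V M N"
  shows "is_struct V M" "is_struct V N" "univ M \<subseteq> univ N"
    "\<And>s xs. s \<in> Funs V \<Longrightarrow> xs \<in> args V s (univ M) \<Longrightarrow> fn N s xs = fn M s xs"
    "\<And>s xs. s \<in> Rels V \<Longrightarrow> xs \<in> args V s (univ M) \<Longrightarrow> xs \<in> rl N s \<longleftrightarrow> xs \<in> rl M s"
  using assms unfolding substruct_def by auto

text \<open>Symbols have finite arity, so this places every argument list in a single member of a
  chain, where homomorphism conditions can be checked.\<close>

lemma chain_finite_subset:
  assumes r: "Well_order r" "Field r \<noteq> {}" and mono: "\<And>i j. (i, j) \<in> r \<Longrightarrow> A i \<subseteq> A j"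
    and X: "finite X" "X \<subseteq> (\<Union>i\<in>Field r. A i)"
  shows "\<exists>i\<in>Field r. X \<subseteq> A i"
  using X
proof (induction X)
  case (insert x X)
  then obtain i j where "i \<in> Field r" "X \<subseteq> A i" "j \<in> Field r" "x \<in> A j" by auto
  then show ?case using Well_order_total[OF r(1), of i j] mono[of i j] mono[of j i] by (meson insert_subset subset_trans subsetD)
qed (use r in auto)

lemma struct_iso_union:
  assumes r: "Well_order r" "Field r \<noteq> {}"
    and iso: "\<And>i. i \<in> Field r \<Longrightarrow> struct_iso V F (A i) (B i)"
    and A: "\<And>i. i \<in> Field r \<Longrightarrow> substruct V (A i) UA" "univ UA = (\<Union>i\<in>Field r. univ (A i))"
    and B: "\<And>i. i \<in> Field r \<Longrightarrow> substruct V (B i) UB" "univ UB = (\<Union>i\<in>Field r. univ (B i))"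
    and mono: "\<And>i j. (i, j) \<in> r \<Longrightarrow> univ (A i) \<subseteq> univ (A j)"
  shows "struct_iso V F UA UB"
proof -
  note isoD = struct_isoD[OF iso]
  obtain i0 where i0: "i0 \<in> Field r" using r by blast
  have loc: "\<exists>i\<in>Field r. xs \<in> args V s (univ (A i))" if "xs \<in> args V s (univ UA)" for xs s
    using chain_finite_subset[OF r, of "\<lambda>i. univ (A i)" "set xs"] mono that A(2) by (auto simp: args_def)
  have inj: "inj_on F (univ UA)"
  proof (rule inj_onI)
    fix x y assume xy: "x \<in> univ UA" "y \<in> univ UA" "F x = F y"
    obtain i where "i \<in> Field r" "{x, y} \<subseteq> univ (A i)"
      using chain_finite_subset[OF r, of "\<lambda>i. univ (A i)" "{x, y}"] mono xy A(2) by auto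
    then show "x = y" using isoD(4) xy(3) by (auto dest: inj_onD)
  qed
  have "F ` univ UA = univ UB" unfolding A(2) B(2) image_UN using isoD(5) by simp
  with inj have "bij_betw F (univ UA) (univ UB)" by (simp add: bij_betw_def)
  moreover have "F (fn UA s xs) = fn UB s (map F xs) " if s: "s \<in> Funs V" "xs \<in> args V s (univ UA)" for s xs
  proof -
    obtain i where i: "i \<in> Field r" "xs \<in> args V s (univ (A i))" using loc s by blast
    have "map F xs \<in> args V s (univ (B i))" by (rule args_map[OF i(2)]) (simp add: isoD(5)[OF i(1)])
    then show ?thesis using substructD(4)[OF A(1)[OF i(1)] s(1) i(2)] isoD(6)[OF i(1) s(1) i(2)]
        substructD(4)[OF B(1)[OF i(1)] s(1)] by simp
  qed
  moreover have "xs \<in> rl UA s \<longleftrightarrow> map F xs \<in> rl UB s" if s: "s \<in> Rels V" "xs \<in> args V s (univ UA)" for s xs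
  proof -
    obtain i where i: "i \<in> Field r" "xs \<in> args V s (univ (A i))" using loc s by blast
    have "map F xs \<in> args V s (univ (B i))" by (rule args_map[OF i(2)]) (simp add: isoD(5)[OF i(1)])
    then show ?thesis using substructD(5)[OF A(1)[OF i(1)] s(1) i(2)] isoD(7)[OF i(1) s(1) i(2)]
        substructD(5)[OF B(1)[OF i(1)] s(1)] by simp
  qed
  ultimately show ?thesis
    using substructD(2)[OF A(1)[OF i0]] substructD(2)[OF B(1)[OF i0]] by (simp add: struct_iso_def)
qed

text \<open>The origin of the room for renaming: removing fewer than \<open>|UNIV|\<close> points
  leaves a complement as large as the whole type, and \<open>X - A\<close> is injected there. Only
  the image of \<open>A\<close> must be small; \<open>X\<close> may be as large as the type.\<close>

lemma inj_extend:
  fixes h :: "'b \<Rightarrow> 'a" and X :: "'b set"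
  assumes h: "inj_on h A" and X: "|X| \<le>o |UNIV :: 'a set|" and inf: "infinite (UNIV :: 'a set)"
    and small: "|h ` A| <o |UNIV :: 'a set|"
  shows "\<exists>k. inj_on k X \<and> (\<forall>x\<in>A. k x = h x)"
proof -
  have "|UNIV - h ` A| =o |UNIV :: 'a set|"
    using card_of_Un_ordLess_infinite[OF inf small, of "UNIV - h ` A"] card_of_mono1[of "UNIV - h ` A" UNIV]
    by (auto simp: ordLeq_iff_ordLess_or_ordIso ordLess_irreflexive)
  then have "|X - A| \<le>o |UNIV - h ` A|"
    using X card_of_mono1[of "X - A" X] by (meson Diff_subset ordIso_symmetric ordLeq_ordIso_trans ordLeq_transitive)
  then obtain e where e: "inj_on e (X - A)" "e ` (X - A) \<subseteq> UNIV - h ` A"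
    using card_of_ordLeq[of "X - A" "UNIV - h ` A"] by blast
  let ?k = "\<lambda>x. if x \<in> A then h x else e x"
  have "inj_on ?k X"
  proof (rule inj_onI)
    fix x y assume *: "x \<in> X" "y \<in> X" "?k x = ?k y"
    have d: "h u \<noteq> e v" if "u \<in> A" "v \<in> X - A" for u v using e(2) that by blast
    show "x = y"
      using * d[of x y] d[of y x] inj_onD[OF h, of x y] inj_onD[OF e(1), of x y] by (auto split: if_splits)
  qed
  then show ?thesis by (intro exI[of _ ?k]) simp
qed

section \<open>Amalgamation and universal extensions\<close>

locale aec_at =
  fixes K :: "('s, 'a) aec" and l :: "'a rel"
  assumes aec: "is_aec K" and Card_order_l: "Card_order l"
    and LS_leq: "LS K \<le>o l" and l_less: "l <o |UNIV :: 'a set|"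
begin

abbreviation "V \<equiv> voc K"

lemma mods_struct: "M \<in> mods K \<Longrightarrow> is_struct V M"
  using aec[unfolded is_aec_def, THEN conjunct1] by blast

lemma leD: "le K M N \<Longrightarrow> M \<in> mods K" "le K M N \<Longrightarrow> N \<in> mods K" "le K M N \<Longrightarrow> substruct V M N"
  using aec[unfolded is_aec_def, THEN conjunct2, THEN conjunct1] by blast+

lemma le_univ: "le K M N \<Longrightarrow> univ M \<subseteq> univ N"
  using leD(3) substructD(3) by blast

lemma le_refl: "M \<in> mods K \<Longrightarrow> le K M M"
  using aec[unfolded is_aec_def, THEN conjunct2, THEN conjunct2, THEN conjunct1] by blast

lemma le_antisym: "le K M N \<Longrightarrow> le K N M \<Longrightarrow> M = N"
  using aec[unfolded is_aec_def, THEN conjunct2, THEN conjunct2, THEN conjunct2, THEN conjunct1] by blast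

lemma le_trans: "le K M N \<Longrightarrow> le K N P \<Longrightarrow> le K M P"
  using aec[unfolded is_aec_def, THEN conjunct2, THEN conjunct2, THEN conjunct2, THEN conjunct2, THEN conjunct1] by blast

lemma mods_iso: "struct_iso V f M N \<Longrightarrow> M \<in> mods K \<Longrightarrow> N \<in> mods K"
  using aec[unfolded is_aec_def, THEN conjunct2, THEN conjunct2, THEN conjunct2, THEN conjunct2, THEN conjunct2, THEN conjunct1] by blast

lemma le_iso: "le K M N \<Longrightarrow> struct_iso V f N N' \<Longrightarrow> struct_iso V f M M' \<Longrightarrow> le K M' N'"
  using aec[unfolded is_aec_def, THEN conjunct2, THEN conjunct2, THEN conjunct2, THEN conjunct2, THEN conjunct2, THEN conjunct2, THEN conjunct1] by blast

lemma coherence: "le K M0 M2 \<Longrightarrow> le K M1 M2 \<Longrightarrow> univ M0 \<subseteq> univ M1 \<Longrightarrow> le K M0 M1"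
  using aec[unfolded is_aec_def, THEN conjunct2, THEN conjunct2, THEN conjunct2, THEN conjunct2, THEN conjunct2, THEN conjunct2, THEN conjunct2, THEN conjunct1] by blast

text \<open>Coherence gives both directions. It serves to identify unions of subchains and of image
  chains with a given model as records.\<close>

lemma le_univ_eq: "le K M P \<Longrightarrow> le K N P \<Longrightarrow> univ M = univ N \<Longrightarrow> M = N"
  by (rule le_antisym) (auto intro: coherence)

lemma limit_union:
  assumes "limit_ord d" "\<forall>i\<in>Field d. M i \<in> mods K" "increasing (le K) d M"
  shows "union_struct V (Field d) M \<in> mods K"
    "\<And>i. i \<in> Field d \<Longrightarrow> le K (M i) (union_struct V (Field d) M)"
    "\<And>N. (\<And>i. i \<in> Field d \<Longrightarrow> le K (M i) N) \<Longrightarrow> le K (union_struct V (Field d) M) N"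
proof -
  have *: "union_struct V (Field d) M \<in> mods K \<and>
        (\<forall>i\<in>Field d. le K (M i) (union_struct V (Field d) M)) \<and>
        (\<forall>N\<in>mods K. (\<forall>i\<in>Field d. le K (M i) N) \<longrightarrow> le K (union_struct V (Field d) M) N)"
    using aec[unfolded is_aec_def, THEN conjunct2, THEN conjunct2, THEN conjunct2, THEN conjunct2, THEN conjunct2, THEN conjunct2, THEN conjunct2, THEN conjunct2, THEN conjunct1] assms by blast
  then show "union_struct V (Field d) M \<in> mods K"
    "\<And>i. i \<in> Field d \<Longrightarrow> le K (M i) (union_struct V (Field d) M)" by blast+
  fix N assume N: "\<And>i. i \<in> Field d \<Longrightarrow> le K (M i) N"
  moreover have "N \<in> mods K" using assms(1) N leD(2) unfolding limit_ord_def by blast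
  ultimately show "le K (union_struct V (Field d) M) N" using * by blast
qed

lemma univ_union_struct: "univ (union_struct V I M) = (\<Union>i\<in>I. univ (M i))"
  by (simp add: union_struct_def)

text \<open>Outside limit order types the chain has a last member, which is its union.\<close>

lemma chain_union:
  assumes "Well_order d" "Field d \<noteq> {}" "\<And>i. i \<in> Field d \<Longrightarrow> M i \<in> mods K" "increasing (le K) d M"
  shows "\<exists>U\<in>mods K. univ U = (\<Union>i\<in>Field d. univ (M i)) \<and> (\<forall>i\<in>Field d. le K (M i) U) \<and>
    (\<forall>N. (\<forall>i\<in>Field d. le K (M i) N) \<longrightarrow> le K U N)"
proof (cases "limit_ord d")
  case True
  then show ?thesis using limit_union[OF True _ assms(4)] assms(3)
    by (intro bexI[of _ "union_struct V (Field d) M"]) (auto simp: univ_union_struct)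
next
  case False
  then obtain m where m: "m \<in> Field d" "\<forall>b\<in>Field d. m = b \<or> (m, b) \<notin> d"
    using assms(1,2) unfolding limit_ord_def cofinal_def by blast
  have "le K (M i) (M m)" if "i \<in> Field d" for i
  proof (cases "i = m")
    case True
    then show ?thesis using assms(3) m le_refl by blast
  next
    case False
    then have "(i, m) \<in> d" using Well_order_total[OF assms(1) that m(1)] m(2) that by metis
    then show ?thesis using assms(4) False unfolding increasing_def by blast
  qed
  moreover from this have "univ (M m) = (\<Union>i\<in>Field d. univ (M i))" using le_univ m by blast
  ultimately show ?thesis using m assms(3) by blast
qed

lemma LS_number_LS: "LS_number K (LS K)"
proof -
  have "\<exists>m. LS_number K m" using aec[unfolded is_aec_def, THEN conjunct2, THEN conjunct2, THEN conjunct2, THEN conjunct2, THEN conjunct2, THEN conjunct2, THEN conjunct2, THEN conjunct2, THEN conjunct2] by blast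
  moreover have "\<And>m. LS_number K m \<Longrightarrow> Card_order m" by (simp add: LS_number_def)
  ultimately have "\<exists>m. LS_number K m \<and> (\<forall>n. LS_number K n \<longrightarrow> m \<le>o n)"
    using exists_minim_Card_order[of "{m. LS_number K m}"] by blast
  then have "LS_number K (LS K) \<and> (\<forall>n. LS_number K n \<longrightarrow> LS K \<le>o n)"
    unfolding LS_def by (rule someI_ex)
  then show ?thesis by blast
qed

lemma Cinfinite_l: "Cinfinite l"
  using LS_number_LS cinfinite_mono[OF LS_leq] Card_order_l by (simp add: LS_number_def)

lemma infinite_UNIV: "infinite (UNIV :: 'a set)"
  using Cinfinite_l card_of_ordLeq_infinite[OF card_of_mono1[of "Field l" UNIV]] by (simp add: cinfinite_def)

lemma K_at_mods: "M \<in> K_at K l \<Longrightarrow> M \<in> mods K"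
  by (simp add: K_at_def)

lemma K_at_card: "M \<in> K_at K l \<Longrightarrow> |univ M| =o l"
  by (simp add: K_at_def)

lemma K_at_small: "M \<in> K_at K l \<Longrightarrow> |univ M| <o |UNIV :: 'a set|"
  using K_at_card l_less ordIso_ordLess_trans by blast

lemma K_at_iso:
  assumes "struct_iso V f M N" "M \<in> K_at K l"
  shows "N \<in> K_at K l"
proof -
  have "|univ M| =o |univ N|" using struct_isoD(3)[OF assms(1)] card_of_ordIso by blast
  then have "|univ N| =o l" using ordIso_transitive[OF ordIso_symmetric K_at_card[OF assms(2)]] by blast
  then show ?thesis using mods_iso[OF assms(1) K_at_mods[OF assms(2)]] by (simp add: K_at_def)
qed

section \<open>Moving models and embeddings\<close>

lemma le_image:
  assumes "le K M N" "struct_iso V f N N'"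
  shows "\<exists>M'. struct_iso V f M M' \<and> le K M' N'"
proof -
  have "inj_on f (univ M)" using struct_isoD(4)[OF assms(2)] le_univ[OF assms(1)] inj_on_subset by blast
  then obtain M' where "struct_iso V f M M'" using struct_iso_image[OF mods_struct[OF leD(1)[OF assms(1)]]] by blast
  then show ?thesis using le_iso assms by blast
qed

text \<open>Points of \<open>N\<close> outside \<open>M\<close> go to fresh places, for which only
  the image of \<open>M\<close> has to be small. \<open>N\<close> may be large, as happens for
  models realizing a type.\<close>

lemma iso_extend:
  assumes f: "struct_iso V f M M1" and N: "le K M N" and small: "|univ M1| <o |UNIV :: 'a set|"
  shows "\<exists>N1 F. struct_iso V F N N1 \<and> le K M1 N1 \<and> (\<forall>x\<in>univ M. F x = f x)"
proof -
  obtain F where F: "inj_on F (univ N)" "\<forall>x\<in>univ M. F x = f x"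
    using inj_extend[OF struct_isoD(4)[OF f], of "univ N"] infinite_UNIV small struct_isoD(5)[OF f]
      card_of_mono1[of "univ N" UNIV] by auto
  obtain N1 where N1: "struct_iso V F N N1" using struct_iso_image[OF mods_struct[OF leD(2)[OF N]] F(1)] by blast
  have "struct_iso V F M M1" using struct_iso_cong[OF f] F(2) by simp
  then show ?thesis using le_iso[OF N N1] N1 F(2) by blast
qed

lemma emb_overI: "struct_iso V f M M' \<Longrightarrow> le K M' N \<Longrightarrow> (\<And>x. x \<in> A \<Longrightarrow> f x = x) \<Longrightarrow> emb_over K A f M N"
  unfolding emb_over_def by blast

lemma emb_over_le: "le K M N \<Longrightarrow> emb_over K A (\<lambda>x. x) M N"
  by (rule emb_overI[OF struct_iso_id[OF mods_struct[OF leD(1)]]]) auto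

lemma emb_over_iso: "struct_iso V f M N \<Longrightarrow> N \<in> mods K \<Longrightarrow> (\<And>x. x \<in> A \<Longrightarrow> f x = x) \<Longrightarrow> emb_over K A f M N"
  by (rule emb_overI[OF _ le_refl]) auto

lemma emb_over_comp:
  assumes "emb_over K A f M N" "emb_over K B g N P" and "\<And>x. x \<in> C \<Longrightarrow> g (f x) = x"
  shows "emb_over K C (\<lambda>x. g (f x)) M P"
proof -
  obtain M' N' where M': "struct_iso V f M M'" "le K M' N" and N': "struct_iso V g N N'" "le K N' P"
    using assms(1,2) unfolding emb_over_def by blast
  obtain M'' where "struct_iso V g M' M''" "le K M'' N'" using le_image[OF M'(2) N'(1)] by blast
  then show ?thesis using emb_overI[OF struct_iso_comp[OF M'(1)] le_trans[OF _ N'(2)] assms(3)] by blast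
qed

lemma emb_over_image: "emb_over K A f M N \<Longrightarrow> x \<in> univ M \<Longrightarrow> f x \<in> univ N"
  unfolding emb_over_def using struct_isoD(5) le_univ by blast

lemma emb_over_mono: "emb_over K A f M N \<Longrightarrow> B \<subseteq> A \<Longrightarrow> emb_over K B f M N"
  unfolding emb_over_def by blast

text \<open>Undoing \<open>f\<close> inside the target turns the embedding into an inclusion; the
  isomorphism \<open>F\<close> of the target remains available for composing other maps into
  \<open>N\<close>.\<close>

lemma emb_normalise:
  assumes "emb_over K A f M N" "|univ M| <o |UNIV :: 'a set|"
  shows "\<exists>N' F. le K M N' \<and> struct_iso V F N N' \<and> (\<forall>x\<in>univ M. F (f x) = x)"
proof -
  obtain M' where M': "struct_iso V f M M'" "le K M' N" using assms(1) unfolding emb_over_def by blast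
  obtain g where g: "struct_iso V g M' M" "\<forall>x\<in>univ M. g (f x) = x" using struct_iso_inv[OF M'(1)] by blast
  obtain N' F where F: "struct_iso V F N N'" "le K M N'" "\<forall>x\<in>univ M'. F x = g x"
    using iso_extend[OF g(1) M'(2) assms(2)] by blast
  have "F (f x) = x" if "x \<in> univ M" for x
  proof -
    have "f x \<in> univ M'" using struct_isoD(5)[OF M'(1)] that by blast
    then show ?thesis using F(3) g(2) that by simp
  qed
  then show ?thesis using F by blast
qed

lemma le_uD:
  assumes "le_u K l M N"
  shows "M \<in> K_at K l" "N \<in> K_at K l" "le K M N"
    "\<And>P. P \<in> K_at K l \<Longrightarrow> le K M P \<Longrightarrow> \<exists>f. emb_over K (univ M) f P N"
  using assms by (simp_all add: le_u_def)

lemma le_u_trans2: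
  assumes "le_u K l M0 M1" "le K M1 M2" "M2 \<in> K_at K l"
  shows "le_u K l M0 M2"
  unfolding le_u_def
proof (intro conjI ballI impI)
  fix P assume "P \<in> K_at K l" "le K M0 P"
  then obtain f where "emb_over K (univ M0) f P M1" using le_uD(4)[OF assms(1)] by blast
  then show "\<exists>f. emb_over K (univ M0) f P M2" using assms(2) le_trans unfolding emb_over_def by blast
qed (use assms le_uD[OF assms(1)] le_trans in blast)+

text \<open>An extension of \<open>M'\<close> is pulled back to an extension of \<open>M\<close>,
  embedded into \<open>N\<close> over \<open>M\<close>, and pushed forward by
  \<open>f\<close>.\<close>

lemma le_u_iso:
  assumes u: "le_u K l M N" and f: "struct_iso V f N N'" "struct_iso V f M M'"
  shows "le_u K l M' N'"
  unfolding le_u_def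
proof (intro conjI ballI impI)
  show M': "M' \<in> K_at K l" and "N' \<in> K_at K l" "le K M' N'"
    using K_at_iso le_iso f le_uD[OF u] by blast+
  fix P assume P: "P \<in> K_at K l" "le K M' P"
  obtain g where g: "struct_iso V g M' M" "\<forall>y\<in>univ M'. f (g y) = y"
    using struct_iso_inv[OF f(2)] by blast
  obtain P' F where F: "struct_iso V F P P'" "le K M P'" "\<forall>x\<in>univ M'. F x = g x"
    using iso_extend[OF g(1) P(2) K_at_small[OF le_uD(1)[OF u]]] by blast
  obtain e where e: "emb_over K (univ M) e P' N" using le_uD(4)[OF u K_at_iso[OF F(1) P(1)] F(2)] by blast
  have P': "P' \<in> mods K" and N': "N' \<in> mods K" using leD(2) F(2) K_at_mods[OF \<open>N' \<in> K_at K l\<close>] by blast+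
  have fix_M: "e (F x) = g x" if "x \<in> univ M'" for x
    using e F(3) that struct_isoD(5)[OF g(1)] unfolding emb_over_def by auto
  have 1: "emb_over K {} (\<lambda>x. e (F x)) P N"
    by (rule emb_over_comp[OF emb_over_iso[OF F(1) P'] e]) auto
  have "emb_over K (univ M') (\<lambda>x. f (e (F x))) P N'"
    by (rule emb_over_comp[OF 1 emb_over_iso[OF f(1) N', of "{}"]]) (use fix_M g(2) in auto)
  then show "\<exists>f. emb_over K (univ M') f P N'" by blast
qed

end

locale aec_ap = aec_at K l for K :: "('s, 'a) aec" and l :: "'a rel" +
  assumes amalg: "has_amalgamation K l" and jep: "has_joint_embedding K l"
begin

text \<open>\<open>A\<close> is the universe of the common submodel for amalgamation and empty for
  joint embedding; either way the first leg becomes an inclusion.\<close>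

lemma amalgam_over:
  assumes K: "M1 \<in> K_at K l" "M2 \<in> K_at K l"
    and ex: "\<exists>N\<in>K_at K l. \<exists>f g. emb_over K A f M1 N \<and> emb_over K A g M2 N" and A: "A \<subseteq> univ M1"
  shows "\<exists>P\<in>K_at K l. \<exists>g. le K M1 P \<and> emb_over K A g M2 P"
proof -
  obtain N f g where N: "N \<in> K_at K l" "emb_over K A f M1 N" "emb_over K A g M2 N" using ex by blast
  obtain P F where P: "le K M1 P" "struct_iso V F N P" "\<forall>x\<in>univ M1. F (f x) = x"
    using emb_normalise[OF N(2) K_at_small[OF K(1)]] by blast
  have fg: "F (g x) = x" if "x \<in> A" for x
    using N(2,3) P(3) that A unfolding emb_over_def by (metis subsetD)
  have "emb_over K A (\<lambda>x. F (g x)) M2 P"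
    by (rule emb_over_comp[OF N(3) emb_over_iso[OF P(2) leD(2)[OF P(1)], of "{}"]]) (use fg in auto)
  then show ?thesis using P(1) K_at_iso[OF P(2) N(1)] by blast
qed

lemma amalgamation:
  assumes "M0 \<in> K_at K l" "M1 \<in> K_at K l" "M2 \<in> K_at K l" "le K M0 M1" "le K M0 M2"
  shows "\<exists>P\<in>K_at K l. \<exists>g. le K M1 P \<and> emb_over K (univ M0) g M2 P"
proof (rule amalgam_over[OF assms(2,3) _ le_univ[OF assms(4)]])
  show "\<exists>N\<in>K_at K l. \<exists>f g. emb_over K (univ M0) f M1 N \<and> emb_over K (univ M0) g M2 N"
    using amalg assms unfolding has_amalgamation_def by blast
qed

lemma joint_embedding:
  assumes "M1 \<in> K_at K l" "M2 \<in> K_at K l"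
  shows "\<exists>P\<in>K_at K l. \<exists>g. le K M1 P \<and> emb_over K {} g M2 P"
proof (rule amalgam_over[OF assms])
  show "\<exists>N\<in>K_at K l. \<exists>f g. emb_over K {} f M1 N \<and> emb_over K {} g M2 N"
    using jep assms unfolding has_joint_embedding_def by blast
qed simp

text \<open>Shrinking the base uses amalgamation: an extension of \<open>M0\<close> is joined with
  \<open>M1\<close> over \<open>M0\<close>, and the amalgam embeds into \<open>M2\<close> over
  \<open>M1\<close>.\<close>

lemma le_u_trans1:
  assumes "M0 \<in> K_at K l" "le K M0 M1" "le_u K l M1 M2"
  shows "le_u K l M0 M2"
  unfolding le_u_def
proof (intro conjI ballI impI)
  fix N assume N: "N \<in> K_at K l" "le K M0 N"
  obtain P g where P: "P \<in> K_at K l" "le K M1 P" "emb_over K (univ M0) g N P"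
    using amalgamation[OF assms(1) le_uD(1)[OF assms(3)] N(1) assms(2) N(2)] by blast
  obtain e where e: "emb_over K (univ M1) e P M2" using le_uD(4)[OF assms(3) P(1,2)] by blast
  have "e (g x) = x" if "x \<in> univ M0" for x
    using e P(3) that le_univ[OF assms(2)] unfolding emb_over_def by (metis subsetD)
  then have "emb_over K (univ M0) (\<lambda>x. e (g x)) N M2" using emb_over_comp[OF P(3) e] by blast
  then show "\<exists>f. emb_over K (univ M0) f N M2" by blast
qed (use assms le_uD[OF assms(3)] le_trans in blast)+

text \<open>Two universal steps anywhere in \<open>K_at K l\<close> yield one over every model:
  \<open>M\<close> embeds into an extension of \<open>N0\<close>, hence into \<open>N1\<close>, and
  a renamed copy of \<open>N2\<close> is universal over the copy of \<open>N1\<close> that contains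
  \<open>M\<close>. Members of the forking chain will play \<open>N0\<close>, \<open>N1\<close>,
  \<open>N2\<close>.\<close>

lemma universal_extension:
  assumes u: "le_u K l N0 N1" "le_u K l N1 N2" and M: "M \<in> K_at K l"
  shows "\<exists>M'. le_u K l M M'"
proof -
  obtain P g where P: "P \<in> K_at K l" "le K N0 P" "emb_over K {} g M P"
    using joint_embedding[OF le_uD(1)[OF u(1)] M] by blast
  obtain e where e: "emb_over K (univ N0) e P N1" using le_uD(4)[OF u(1) P(1,2)] by blast
  obtain N' F where N': "le K M N'" "struct_iso V F N1 N'"
    using emb_normalise[OF emb_over_comp[OF P(3) e, of "{}"] K_at_small[OF M]] by blast
  have N'K: "N' \<in> K_at K l" using K_at_iso[OF N'(2)] le_uD(1)[OF u(2)] by blast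
  obtain N2' F2 where F2: "struct_iso V F2 N2 N2'" "\<forall>x\<in>univ N1. F2 x = F x"
    using iso_extend[OF N'(2) le_uD(3)[OF u(2)] K_at_small[OF N'K]] by blast
  have "struct_iso V F2 N1 N'" using struct_iso_cong[OF N'(2)] F2(2) by simp
  then have "le_u K l N' N2'" using le_u_iso[OF u(2) F2(1)] by blast
  then show ?thesis using le_u_trans1[OF M N'(1)] by blast
qed

end

section \<open>Galois types\<close>

context aec_at
begin

text \<open>The well-formed representatives. Off them \<open>gtp\<close> is the empty set, so
  equality of types is informative only if one side is known to be well-formed.\<close>

definition triple :: "'a \<Rightarrow> 'a set \<Rightarrow> ('s, 'a) struct \<Rightarrow> bool" where
  "triple a A N \<longleftrightarrow> N \<in> mods K \<and> a \<in> univ N \<and> A \<subseteq> univ N"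

lemma E_atI:
  assumes "triple a A M" "triple b A N" "emb_over K A f M P" "emb_over K A g N P" "f a = g b"
  shows "((a, A, M), (b, A, N)) \<in> E_at K"
proof -
  have "P \<in> mods K" using assms(3) leD(2) unfolding emb_over_def by blast
  then show ?thesis using assms unfolding E_at_def triple_def by blast
qed

lemma E_atD:
  assumes "((a, A, M), (b, B, N)) \<in> E_at K"
  shows "B = A" "triple a A M" "triple b A N"
    "\<exists>P\<in>mods K. \<exists>f g. emb_over K A f M P \<and> emb_over K A g N P \<and> f a = g b"
proof -
  have *: "M \<in> mods K \<and> N \<in> mods K \<and> a \<in> univ M \<and> b \<in> univ N \<and> A = B \<and> A \<subseteq> univ M \<and> A \<subseteq> univ N \<and>
     (\<exists>P\<in>mods K. \<exists>f g. emb_over K A f M P \<and> emb_over K A g N P \<and> f a = g b)"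
    using assms[unfolded E_at_def mem_Collect_eq case_prod_conv] .
  then show "B = A" by blast
  show "triple a A M" "triple b A N"
    "\<exists>P\<in>mods K. \<exists>f g. emb_over K A f M P \<and> emb_over K A g N P \<and> f a = g b"
    using * unfolding triple_def by blast+
qed

lemma E_at_sym: "sym (E_at K)"
  unfolding sym_def
proof (intro allI impI)
  fix x y assume xy: "(x, y) \<in> E_at K"
  obtain a A M b B N where x: "x = (a, A, M)" "y = (b, B, N)" using prod_cases3 by metis
  note D = E_atD[OF xy[unfolded x]]
  obtain P f g where P: "emb_over K A f M P" "emb_over K A g N P" "f a = g b" using D(4) by blast
  show "(y, x) \<in> E_at K" unfolding x D(1) by (rule E_atI[OF D(3,2) P(2,1) P(3)[symmetric]])
qed

lemma triple_refl:
  assumes "triple a A M"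
  shows "((a, A, M), (a, A, M)) \<in> (E_at K)\<^sup>+"
proof -
  have "emb_over K A (\<lambda>x. x) M M" using assms by (simp add: triple_def emb_over_le le_refl)
  then show ?thesis using E_atI[OF assms assms] by blast
qed

lemma E_trancl_triple:
  assumes "((a, A, M), (b, B, N)) \<in> (E_at K)\<^sup>+"
  shows "B = A" "triple a A M" "triple b A N"
proof -
  have *: "fst (snd y) = fst (snd x) \<and> triple (fst x) (fst (snd x)) (snd (snd x)) \<and> triple (fst y) (fst (snd y)) (snd (snd y))"
    if "(x, y) \<in> (E_at K)\<^sup>+" for x y
    using that
  proof (induction rule: trancl_induct)
    case (base y)
    obtain a A M b B N where x: "x = (a, A, M)" "y = (b, B, N)" using prod_cases3 by metis
    show ?case using E_atD(1-3)[OF base[unfolded x]] by (simp add: x)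
  next
    case (step y z)
    obtain a A M b B N where x: "y = (a, A, M)" "z = (b, B, N)" using prod_cases3 by metis
    show ?case using E_atD(1-3)[OF step(2)[unfolded x]] step.IH by (simp add: x)
  qed
  show "B = A" "triple a A M" "triple b A N" using *[OF assms] by auto
qed

lemma gtp_eq_iff:
  assumes "triple a A M"
  shows "gtp K a A M = gtp K b A N \<longleftrightarrow> ((a, A, M), (b, A, N)) \<in> (E_at K)\<^sup>+"
proof -
  have s: "sym ((E_at K)\<^sup>+)" using E_at_sym by (rule sym_trancl)
  have t: "trans ((E_at K)\<^sup>+)" by (rule trans_trancl)
  show ?thesis
  proof
    assume "gtp K a A M = gtp K b A N"
    then have "((b, A, N), (a, A, M)) \<in> (E_at K)\<^sup>+"
      using triple_refl[OF assms] unfolding gtp_def by blast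
    then show "((a, A, M), (b, A, N)) \<in> (E_at K)\<^sup>+" using s by (rule symD[rotated])
  next
    assume 1: "((a, A, M), (b, A, N)) \<in> (E_at K)\<^sup>+"
    then have 2: "((b, A, N), (a, A, M)) \<in> (E_at K)\<^sup>+" using s by (rule symD[rotated])
    show "gtp K a A M = gtp K b A N"
      unfolding gtp_def using transD[OF t 1] transD[OF t 2] by blast
  qed
qed

text \<open>\<open>N\<close> itself serves as the amalgam, with the identity as second map.\<close>

lemma gtp_emb:
  assumes "triple a A M" "emb_over K A f M N"
  shows "gtp K a A M = gtp K (f a) A N"
proof -
  have N: "N \<in> mods K" using assms(2) leD(2) unfolding emb_over_def by blast
  have f: "f x = x" if "x \<in> A" for x using assms(2) that by (simp add: emb_over_def)
  have M: "a \<in> univ M" "A \<subseteq> univ M" using assms(1) by (auto simp: triple_def)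
  have "x \<in> univ N" if "x \<in> A" for x
    using emb_over_image[OF assms(2) subsetD[OF M(2) that]] f[OF that] by simp
  then have t: "triple (f a) A N" using N emb_over_image[OF assms(2) M(1)] by (auto simp: triple_def)
  have "((a, A, M), (f a, A, N)) \<in> E_at K"
    using E_atI[where g = "\<lambda>x. x", OF assms(1) t assms(2) emb_over_le[OF le_refl[OF N]]] by simp
  then show ?thesis using gtp_eq_iff[OF assms(1)] by blast
qed

lemma gtp_le: "triple a A M \<Longrightarrow> le K M N \<Longrightarrow> gtp K a A M = gtp K a A N"
  using gtp_emb[where f = "\<lambda>x. x"] emb_over_le by blast

lemma E_at_mono:
  assumes "((a, A, M), (b, A, N)) \<in> E_at K" "B \<subseteq> A"
  shows "triple a B M" "((a, B, M), (b, B, N)) \<in> E_at K"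
proof -
  note D = E_atD[OF assms(1)]
  obtain P f g where P: "emb_over K A f M P" "emb_over K A g N P" "f a = g b" using D(4) by blast
  show t: "triple a B M" using D(2) assms(2) by (auto simp: triple_def)
  have "triple b B N" using D(3) assms(2) by (auto simp: triple_def)
  then show "((a, B, M), (b, B, N)) \<in> E_at K"
    using E_atI[OF t _ emb_over_mono[OF P(1) assms(2)] emb_over_mono[OF P(2) assms(2)] P(3)] by blast
qed

text \<open>The two representatives need not have a common amalgam, so the restriction is carried
  out link by link along the \<open>E_at\<close> sequence.\<close>

lemma gtp_mono:
  assumes "triple a A M" "gtp K a A M = gtp K b A N" "B \<subseteq> A"
  shows "gtp K a B M = gtp K b B N"
proof -
  have *: "fst (snd y) = A \<and> gtp K a B M = gtp K (fst y) B (snd (snd y))"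
    if "((a, A, M), y) \<in> (E_at K)\<^sup>+" for y
    using that
  proof (induction rule: trancl_induct)
    case (base y)
    obtain b C N where y: "y = (b, C, N)" using prod_cases3 by metis
    have C: "C = A" using E_atD(1)[OF base[unfolded y]] .
    show ?case using gtp_eq_iff E_at_mono[OF base[unfolded y C] assms(3)] by (auto simp: y C)
  next
    case (step y z)
    obtain b C N where y: "y = (b, C, N)" using prod_cases3 by metis
    obtain c D P where z: "z = (c, D, P)" using prod_cases3 by metis
    have C: "C = A" using step.IH by (simp add: y)
    have D: "D = A" using E_atD(1)[OF step(2)[unfolded y z]] C by simp
    show ?case using gtp_eq_iff E_at_mono[OF step(2)[unfolded y z C D] assms(3)] step.IH by (auto simp: y z D)
  qed
  show ?thesis using *[of "(b, A, N)"] assms gtp_eq_iff[OF assms(1)] by simp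
qed

text \<open>All representatives restrict to the same type, so the union in \<open>gres\<close> has
  only one distinct member.\<close>

lemma gres_gtp:
  assumes "triple a B N" "A \<subseteq> B"
  shows "gres K (gtp K a B N) A = gtp K a A N"
proof -
  have *: "gtp K b A P = gtp K a A N" if "(b, C, P) \<in> gtp K a B N" for b C P
  proof -
    have e: "((a, B, N), (b, C, P)) \<in> (E_at K)\<^sup>+" using that by (simp add: gtp_def)
    then have "C = B" by (rule E_trancl_triple(1))
    then show ?thesis using gtp_mono[OF assms(1) _ assms(2), of b P] e gtp_eq_iff[OF assms(1)] by simp
  qed
  have "(a, B, N) \<in> gtp K a B N" using triple_refl[OF assms(1)] by (simp add: gtp_def)
  then have "gtp K a A N \<subseteq> gres K (gtp K a B N) A" unfolding gres_def by blast
  moreover have "gres K (gtp K a B N) A \<subseteq> gtp K a A N"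
    unfolding gres_def by (rule UN_least) (clarsimp simp: *)
  ultimately show ?thesis by blast
qed

text \<open>The two given isomorphisms say nothing about the intermediate models of the
  \<open>E_at\<close> sequence. Each of these is copied along some extension of \<open>h\<close>,
  which exists because \<open>A\<close> is small, and every link is compared inside a copy of its
  amalgam.\<close>

lemma gtp_transport:
  assumes eq: "gtp K a A M = gtp K b A N" and t: "triple a A M" and small: "|A| <o |UNIV :: 'a set|"
    and H: "struct_iso V H M M1" "\<forall>x\<in>A. H x = h x"
    and H': "struct_iso V H' N N1" "\<forall>x\<in>A. H' x = h x"
  shows "gtp K (H a) (h ` A) M1 = gtp K (H' b) (h ` A) N1"
proof -
  have inj: "inj_on h A"
    using H t struct_isoD(4)[OF H(1)] inj_on_subset[of H "univ M" A] inj_on_cong[of A H h] unfolding triple_def by blast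
  have small': "|h ` A| <o |UNIV :: 'a set|"
    using small card_of_image[of h A] ordLeq_ordLess_trans by blast
  have copy: "\<exists>P1 k. struct_iso V k P P1 \<and> (\<forall>x\<in>A. k x = h x)" if "P \<in> mods K" for P
    using inj_extend[OF inj _ infinite_UNIV small', of "univ P"] card_of_mono1[of "univ P" UNIV]
      struct_iso_image[OF mods_struct[OF that]] by blast
  have one_step: "gtp K (H1 c) (h ` A) P1 = gtp K (H2 d) (h ` A) Q1"
    if e: "((c, A, P), (d, A, Q)) \<in> E_at K"
      and H1: "struct_iso V H1 P P1" "\<forall>x\<in>A. H1 x = h x"
      and H2: "struct_iso V H2 Q Q1" "\<forall>x\<in>A. H2 x = h x" for c d P Q H1 H2 P1 Q1
  proof -
    obtain R f g where R: "triple c A P" "triple d A Q" "R \<in> mods K"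
      "emb_over K A f P R" "emb_over K A g Q R" "f c = g d"
      using E_atD[OF e] by blast
    obtain k R1 where k: "struct_iso V k R R1" "\<forall>x\<in>A. k x = h x" using copy[OF R(3)] by blast
    have R1: "R1 \<in> mods K" using mods_iso k(1) R(3) by blast
    have one: "gtp K (G u) (h ` A) S1 = gtp K (k (e u)) (h ` A) R1"
      if u: "triple u A S" and e: "emb_over K A e S R" and G: "struct_iso V G S S1" "\<forall>x\<in>A. G x = h x"
      for u S e G S1
    proof -
      have S1: "S1 \<in> mods K" using mods_iso[OF G(1)] u by (simp add: triple_def)
      obtain G' where G': "struct_iso V G' S1 S" "\<forall>x\<in>univ S. G' (G x) = x"
        using struct_iso_inv[OF G(1)] by blast
      have S: "S \<in> mods K" using u by (simp add: triple_def)
      have t1: "triple (G u) (h ` A) S1"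
        using u S1 struct_isoD(5)[OF G(1)] G(2) unfolding triple_def by (metis (no_types, lifting) image_mono imageI image_cong)
      have G'h: "G' (h x) = x" if "x \<in> A" for x using G'(2) G(2) u that unfolding triple_def by (metis subsetD)
      have eG: "emb_over K {} (\<lambda>x. e (G' x)) S1 R"
        by (rule emb_over_comp[OF emb_over_iso[OF G'(1) S, of "{}"] e]) auto
      have "emb_over K (h ` A) (\<lambda>x. k (e (G' x))) S1 R1"
      proof (rule emb_over_comp[OF eG emb_over_iso[OF k(1) R1, of "{}"]])
        fix x assume "x \<in> h ` A"
        then obtain y where y: "y \<in> A" "x = h y" by blast
        moreover have "e y = y" using e y(1) by (simp add: emb_over_def)
        ultimately show "k (e (G' x)) = x" using G'h k(2) by simp
      qed simp
      from gtp_emb[OF t1 this] show ?thesis using G'(2) u by (simp add: triple_def)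
    qed
    show ?thesis using one[OF R(1,4) H1] one[OF R(2,5) H2] R(6) by simp
  qed
  have all: "\<forall>H' N1. struct_iso V H' (snd (snd y)) N1 \<and> (\<forall>x\<in>A. H' x = h x) \<longrightarrow>
      gtp K (H a) (h ` A) M1 = gtp K (H' (fst y)) (h ` A) N1"
    if "((a, A, M), y) \<in> (E_at K)\<^sup>+" for y
    using that
  proof (induction rule: trancl_induct)
    case (base y)
    obtain b C N where y: "y = (b, C, N)" using prod_cases3 by metis
    have "C = A" using E_atD(1)[OF base[unfolded y]] .
    then show ?case using one_step[OF base[unfolded y \<open>C = A\<close>] H] by (simp add: y)
  next
    case (step y z)
    obtain b C N where y: "y = (b, C, N)" using prod_cases3 by metis
    obtain c D P where z: "z = (c, D, P)" using prod_cases3 by metis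
    have C: "C = A" "N \<in> mods K" using E_trancl_triple[OF step(1)[unfolded y]] by (auto simp: triple_def)
    have D: "D = A" using E_atD(1)[OF step(2)[unfolded y z]] C(1) by simp
    obtain k N' where k: "struct_iso V k N N'" "\<forall>x\<in>A. k x = h x" using copy[OF C(2)] by blast
    then show ?case using step.IH one_step[OF step(2)[unfolded y z C(1) D] k] by (simp add: y z)
  qed
  show ?thesis using all[of "(b, A, N)"] eq gtp_eq_iff[OF t] H' by simp
qed

text \<open>Types may be realized in models of any size, whereas universality only concerns
  \<open>K_at K l\<close>. The size bound works because \<open>insert a (univ M0)\<close> and
  \<open>LS K\<close> both have size at most \<open>l\<close>; coherence gives
  \<open>le K M0 N\<close>.\<close>

lemma lst_extension:
  assumes "le K M0 M" "M0 \<in> K_at K l" "a \<in> univ M"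
  shows "\<exists>N\<in>K_at K l. le K M0 N \<and> le K N M \<and> a \<in> univ N"
proof -
  let ?A = "insert a (univ M0)"
  have A: "?A \<subseteq> univ M" using assms le_univ by blast
  have LS: "Card_order (LS K)" "\<forall>M\<in>mods K. \<forall>A. A \<subseteq> univ M \<longrightarrow>
        (\<exists>N. le K N M \<and> A \<subseteq> univ N \<and> |univ N| \<le>o |A| +c LS K)"
    using LS_number_LS by (auto simp: LS_number_def)
  obtain N where N: "le K N M" "?A \<subseteq> univ N" "|univ N| \<le>o |?A| +c LS K"
    using LS(2) A leD(2)[OF assms(1)] by blast
  have inf: "infinite (Field l)" using Cinfinite_l by (simp add: cinfinite_def)
  then have "|{a}| \<le>o |Field l|" by (intro card_of_singl_ordLeq) auto
  then have "|{a}| \<le>o l" using card_of_Field_ordIso[OF Card_order_l] ordLeq_ordIso_trans by blast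
  moreover have "|univ M0| \<le>o l" using K_at_card[OF assms(2)] ordIso_iff_ordLeq by blast
  ultimately have "|?A| \<le>o l"
    using card_of_Un_ordLeq_infinite_Field[OF inf, of "{a}" "univ M0"] Card_order_l by simp
  then have "|?A| +c LS K \<le>o l"
    using csum_cinfinite_bound[OF _ LS_leq card_of_Card_order LS(1) Cinfinite_l] by blast
  then have "|univ N| \<le>o l" using N(3) ordLeq_transitive by blast
  moreover have "l \<le>o |univ N|"
    using K_at_card[OF assms(2)] card_of_mono1[of "univ M0" "univ N"] N(2)
    by (meson insert_subset ordIso_ordLeq_trans ordIso_symmetric)
  ultimately have "N \<in> K_at K l" using leD(1)[OF N(1)] by (simp add: K_at_def ordIso_iff_ordLeq)
  moreover have "le K M0 N" using coherence[OF assms(1) N(1)] N(2) by blast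
  ultimately show ?thesis using N by blast
qed

lemma triple_le: "le K M N \<Longrightarrow> a \<in> univ N \<Longrightarrow> A \<subseteq> univ M \<Longrightarrow> triple a A N"
  using le_univ leD(2) unfolding triple_def by blast

lemma gS_cases:
  assumes "p \<in> gS K M"
  obtains a N where "p = gtp K a (univ M) N" "le K M N" "a \<in> univ N" "triple a (univ M) N"
proof -
  obtain a N where "p = gtp K a (univ M) N" "le K M N" "a \<in> univ N" using assms unfolding gS_def by blast
  then show ?thesis using that triple_le[OF _ _ subset_refl] by metis
qed

lemma gtp_realized:
  assumes u: "le_u K l M0 M1" and a: "le K M0 N" "a \<in> univ N"
  shows "\<exists>b\<in>univ M1. gtp K a (univ M0) N = gtp K b (univ M0) M1"
proof -
  obtain N' where N': "N' \<in> K_at K l" "le K M0 N'" "le K N' N" "a \<in> univ N'"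
    using lst_extension[OF a(1) le_uD(1)[OF u] a(2)] by blast
  obtain e where e: "emb_over K (univ M0) e N' M1" using le_uD(4)[OF u N'(1,2)] by blast
  have "triple a (univ M0) N'" using triple_le N' by blast
  then have "gtp K a (univ M0) N = gtp K (e a) (univ M0) M1" using gtp_emb[OF _ e] gtp_le[OF _ N'(3)] by metis
  then show ?thesis using emb_over_image[OF e N'(4)] by blast
qed

end

section \<open>Chains and uniqueness of limit models\<close>

lemma struct_iso_glue:
  assumes r: "Well_order r" "Field r \<noteq> {}"
    and iso: "\<And>i. i \<in> Field r \<Longrightarrow> struct_iso V (f i) (A i) (B i)"
    and coh: "\<And>i j x. (i, j) \<in> r \<Longrightarrow> x \<in> univ (A i) \<Longrightarrow> f j x = f i x"
    and A: "\<And>i. i \<in> Field r \<Longrightarrow> substruct V (A i) UA" "univ UA = (\<Union>i\<in>Field r. univ (A i))"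
    and B: "\<And>i. i \<in> Field r \<Longrightarrow> substruct V (B i) UB" "univ UB = (\<Union>i\<in>Field r. univ (B i))"
    and mono: "\<And>i j. (i, j) \<in> r \<Longrightarrow> univ (A i) \<subseteq> univ (A j)"
  shows "\<exists>F. struct_iso V F UA UB \<and> (\<forall>i\<in>Field r. \<forall>x\<in>univ (A i). F x = f i x)"
proof -
  let ?F = "\<lambda>x. f (SOME i. i \<in> Field r \<and> x \<in> univ (A i)) x"
  have F: "?F x = f i x" if ix: "i \<in> Field r" "x \<in> univ (A i)" for i x
  proof -
    let ?k = "SOME i. i \<in> Field r \<and> x \<in> univ (A i)"
    have k: "?k \<in> Field r \<and> x \<in> univ (A ?k)" using that by (intro someI[of "\<lambda>i. i \<in> Field r \<and> x \<in> univ (A i)" i]) simp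
    consider "(i, ?k) \<in> r" | "(?k, i) \<in> r" using Well_order_total[OF r(1) ix(1) conjunct1[OF k]] by blast
    then show ?thesis using coh[of i ?k x] coh[of ?k i x] k ix by cases auto
  qed
  have "struct_iso V ?F UA UB"
  proof (rule struct_iso_union[OF r _ A B mono])
    fix i assume "i \<in> Field r"
    then show "struct_iso V ?F (A i) (B i)" using struct_iso_cong[OF iso, of i ?F] F by simp
  qed
  then show ?thesis using F by (intro exI[of _ ?F]) simp
qed

lemma Restr_underS:
  assumes "Well_order d"
  shows "Well_order (Restr d (underS d j))" "Field (Restr d (underS d j)) = underS d j"
proof -
  show "Well_order (Restr d (underS d j))" using assms by (rule Well_order_Restr)
  have "wo_rel d" using assms by (simp add: wo_rel_def)
  then show "Field (Restr d (underS d j)) = underS d j"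
    using Field_Restr_ofilter[OF assms wo_rel.underS_ofilter] by blast
qed

context aec_at
begin

lemma K_at_between:
  assumes "M \<in> K_at K l" "N \<in> K_at K l" "le K M A" "le K A N"
  shows "A \<in> K_at K l"
proof -
  have "l \<le>o |univ A|" "|univ A| \<le>o l"
    using K_at_card[OF assms(1)] K_at_card[OF assms(2)] card_of_mono1[OF le_univ[OF assms(3)]]
      card_of_mono1[OF le_univ[OF assms(4)]]
    by (metis ordIso_symmetric ordIso_ordLeq_trans) (metis ordLeq_ordIso_trans K_at_card[OF assms(2)] card_of_mono1[OF le_univ[OF assms(4)]])
  then show ?thesis using leD(1)[OF assms(4)] by (simp add: K_at_def ordIso_iff_ordLeq)
qed

lemma union_K_at:
  assumes "I \<noteq> {}" "|I| \<le>o l" "\<And>i. i \<in> I \<Longrightarrow> M i \<in> K_at K l" "U \<in> mods K" "univ U = (\<Union>i\<in>I. univ (M i))"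
  shows "U \<in> K_at K l"
proof -
  have inf: "infinite (Field l)" using Cinfinite_l by (simp add: cinfinite_def)
  have "\<forall>i\<in>I. |univ (M i)| \<le>o l" using assms(3) K_at_card ordIso_iff_ordLeq by blast
  then have "|univ U| \<le>o l"
    unfolding assms(5) by (rule card_of_UNION_ordLeq_infinite_Field[OF inf Card_order_l assms(2)])
  moreover obtain i where i: "i \<in> I" using assms(1) by blast
  then have "univ (M i) \<subseteq> univ U" using assms(5) by blast
  then have "l \<le>o |univ U|"
    using ordIso_ordLeq_trans[OF ordIso_symmetric[OF K_at_card[OF assms(3)[OF i]]] card_of_mono1] by blast
  ultimately show ?thesis using assms(4) by (simp add: K_at_def ordIso_iff_ordLeq)
qed

text \<open>Successor and limit stages are treated at once: \<open>U\<close> is the last member of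
  the segment if there is one, and the union otherwise. Recursions along \<open>d\<close> then need
  no such case split.\<close>

lemma segment_union:
  fixes d :: "'a rel"
  assumes d: "Well_order d" "|Field d| \<le>o l" and ne: "underS d j \<noteq> {}"
    and M: "\<And>i. i \<in> underS d j \<Longrightarrow> M i \<in> K_at K l"
    and inc: "\<And>i k. i \<in> underS d k \<Longrightarrow> k \<in> underS d j \<Longrightarrow> le K (M i) (M k)"
  shows "\<exists>U\<in>K_at K l. univ U = (\<Union>i\<in>underS d j. univ (M i)) \<and> (\<forall>i\<in>underS d j. le K (M i) U) \<and>
    (\<forall>N. (\<forall>i\<in>underS d j. le K (M i) N) \<longrightarrow> le K U N)"
proof -
  let ?r = "Restr d (underS d j)"
  note r = Restr_underS[OF d(1), of j]
  have *: "\<exists>U\<in>mods K. univ U = (\<Union>i\<in>Field ?r. univ (M i)) \<and> (\<forall>i\<in>Field ?r. le K (M i) U) \<and>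
    (\<forall>N. (\<forall>i\<in>Field ?r. le K (M i) N) \<longrightarrow> le K U N)"
  proof (rule chain_union[OF r(1)])
    show "increasing (le K) ?r M" using inc unfolding increasing_def by (auto simp: underS_def)
  qed (use ne M K_at_mods r(2) in auto)
  have "underS d j \<subseteq> Field d" by (auto simp: underS_def Field_def)
  then have c: "|underS d j| \<le>o l" using card_of_mono1 d(2) ordLeq_transitive by blast
  obtain U where U: "U \<in> mods K" "univ U = (\<Union>i\<in>underS d j. univ (M i))" "\<forall>i\<in>underS d j. le K (M i) U"
    "\<forall>N. (\<forall>i\<in>underS d j. le K (M i) N) \<longrightarrow> le K U N"
    using * unfolding r(2) by blast
  show ?thesis using union_K_at[OF ne c M U(1,2)] U by blast
qed

end

section \<open>Building and comparing universal chains\<close>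

context aec_ap
begin

text \<open>Stage \<open>j\<close> is a universal extension of the union of the earlier stages. The
  chain is thus universal between any two indices without being continuous, which is the kind of
  chain that \<open>u_chain\<close> describes.\<close>

lemma u_chain_exists:
  fixes d :: "'a rel"
  assumes ue: "\<And>M. M \<in> K_at K l \<Longrightarrow> \<exists>M'. le_u K l M M'"
    and d: "Well_order d" "|Field d| \<le>o l" and M: "M \<in> K_at K l"
  shows "\<exists>Z. (\<forall>k\<in>Field d. le_u K l M (Z k)) \<and> increasing (le_u K l) d Z"
proof -
  let ?P = "\<lambda>j Z X. le_u K l M X \<and> (\<forall>i\<in>underS d j. le_u K l (Z i) X)"
  have "\<exists>Z. \<forall>j\<in>Field d. ?P j Z (Z j)"
  proof (rule transfinite_choice[OF d(1)])
    fix j Z assume j: "j \<in> Field d" and IH: "\<And>i. i \<in> underS d j \<Longrightarrow> ?P i Z (Z i)"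
    show "\<exists>X. ?P j Z X"
    proof (cases "underS d j = {}")
      case True
      then show ?thesis using ue[OF M] by auto
    next
      case False
      have Z: "\<And>i. i \<in> underS d j \<Longrightarrow> Z i \<in> K_at K l" using IH le_uD(2) by blast
      have inc: "\<And>i k. i \<in> underS d k \<Longrightarrow> k \<in> underS d j \<Longrightarrow> le K (Z i) (Z k)" using IH le_uD(3) by blast
      obtain U where U: "U \<in> K_at K l" "\<forall>i\<in>underS d j. le K (Z i) U"
        using segment_union[where M = Z, OF d False Z inc] by blast
      obtain X where X: "le_u K l U X" using ue[OF U(1)] by blast
      obtain i where i: "i \<in> underS d j" using False by blast
      have "le K M U" using le_trans le_uD(3) IH[OF i] U(2) i by blast
      then have "le_u K l M X" using le_u_trans1[OF M _ X] by blast
      moreover have "\<forall>i\<in>underS d j. le_u K l (Z i) X" using le_u_trans1[OF Z _ X] U(2) by blast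
      ultimately show ?thesis by blast
    qed
  qed simp
  then obtain Z where Z: "\<And>j. j \<in> Field d \<Longrightarrow> ?P j Z (Z j)" by blast
  have "increasing (le_u K l) d Z" unfolding increasing_def
  proof (intro allI impI)
    fix i j assume "(i, j) \<in> d \<and> i \<noteq> j"
    then have "j \<in> Field d" "i \<in> underS d j" by (auto simp: Field_def underS_def)
    then show "le_u K l (Z i) (Z j)" using Z by blast
  qed
  then show ?thesis using Z by blast
qed

text \<open>Forth and back at once: embedding \<open>P\<close> into \<open>N'\<close> over
  \<open>N\<close> gives \<open>B\<close>; pulling \<open>B\<close> back to an extension of
  \<open>M\<close> and embedding that into \<open>M'\<close> over \<open>M\<close> gives
  \<open>A\<close>. The map \<open>f\<close> follows \<open>w\<close> where \<open>w\<close> lands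
  in \<open>N\<close>, because the embedding of \<open>P\<close> fixes \<open>N\<close>.\<close>

lemma back_and_forth_step:
  assumes M: "le_u K l M M'" and N: "le_u K l N N'" and P: "P \<in> K_at K l" "le K N P"
    and w: "emb_over K {} w M P"
  shows "\<exists>A B f. le K M A \<and> le K A M' \<and> le K N B \<and> le K B N' \<and> struct_iso V f A B \<and>
    (\<forall>x\<in>univ M. w x \<in> univ N \<longrightarrow> f x = w x)"
proof -
  \<comment> \<open>A map fixing \<open>C\<close> pointwise carries extensions of \<open>C\<close>
    to extensions of \<open>C\<close>.\<close>
  have fixed: "le K C D" if "le K C C'" "struct_iso V e C' D" "\<forall>x\<in>univ C. e x = x" for C C' D e
  proof -
    have "struct_iso V e C C" using struct_iso_cong[OF struct_iso_id[OF mods_struct[OF leD(1)[OF that(1)]]]] that(3) by simp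
    then show ?thesis using le_iso[OF that(1,2)] by blast
  qed
  obtain e where "emb_over K (univ N) e P N'" using le_uD(4)[OF N P] by blast
  then obtain B where B: "struct_iso V e P B" "le K B N'" and e: "\<forall>x\<in>univ N. e x = x"
    unfolding emb_over_def by blast
  obtain W where W: "struct_iso V w M W" "le K W P" using w unfolding emb_over_def by blast
  obtain W1 where W1: "struct_iso V e W W1" "le K W1 B" using le_image[OF W(2) B(1)] by blast
  have ew: "struct_iso V (\<lambda>x. e (w x)) M W1" using struct_iso_comp[OF W(1) W1(1)] .
  obtain g where g: "struct_iso V g W1 M" "\<forall>x\<in>univ M. g (e (w x)) = x"
    using struct_iso_inv[OF ew] by blast
  obtain A' G where G: "struct_iso V G B A'" "le K M A'" "\<forall>x\<in>univ W1. G x = g x"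
    using iso_extend[OF g(1) W1(2) K_at_small[OF le_uD(1)[OF M]]] by blast
  have A': "A' \<in> K_at K l" using K_at_iso[OF G(1) K_at_iso[OF B(1) P(1)]] .
  obtain e' where "emb_over K (univ M) e' A' M'" using le_uD(4)[OF M A' G(2)] by blast
  then obtain A where A: "struct_iso V e' A' A" "le K A M'" and e': "\<forall>x\<in>univ M. e' x = x"
    unfolding emb_over_def by blast
  obtain f where f: "struct_iso V f A B" "\<forall>y\<in>univ B. f (e' (G y)) = y"
    using struct_iso_inv[OF struct_iso_comp[OF G(1) A(1)]] by blast
  have "f x = w x" if x: "x \<in> univ M" "w x \<in> univ N" for x
  proof -
    have W1x: "e (w x) \<in> univ W1" using struct_isoD(5)[OF ew] x(1) by blast
    then have "e' (G (e (w x))) = x" using G(3) g(2) e' x(1) by simp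
    moreover have "f (e' (G (e (w x)))) = e (w x)" using f(2) W1x le_univ[OF W1(2)] by blast
    ultimately show ?thesis using e x(2) by simp
  qed
  then show ?thesis using fixed[OF G(2) A(1) e'] A(2) fixed[OF P(2) B(1) e] B(2) f(1) by blast
qed

text \<open>\<open>F\<close> is extended to \<open>M\<close>, and its new target is amalgamated with
  \<open>N\<close> over \<open>W\<close>. The resulting map into the amalgam equals \<open>F\<close>
  on \<open>U\<close> and lands in \<open>N\<close> there, so the step preserves it.\<close>

lemma back_and_forth_extend:
  assumes M: "le_u K l M M'" and N: "le_u K l N N'"
    and U: "U \<in> K_at K l" "W \<in> K_at K l" "le K U M" "le K W N" and F: "struct_iso V F U W"
  shows "\<exists>A B f. le K M A \<and> le K A M' \<and> le K N B \<and> le K B N' \<and> struct_iso V f A B \<and>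
    (\<forall>x\<in>univ U. f x = F x)"
proof -
  obtain Q F' where F': "struct_iso V F' M Q" "le K W Q" "\<forall>x\<in>univ U. F' x = F x"
    using iso_extend[OF F U(3) K_at_small[OF U(2)]] by blast
  have Q: "Q \<in> K_at K l" using K_at_iso[OF F'(1) le_uD(1)[OF M]] .
  obtain P e where P: "P \<in> K_at K l" "le K N P" "emb_over K (univ W) e Q P"
    using amalgamation[OF U(2) le_uD(1)[OF N] Q U(4) F'(2)] by blast
  have w: "emb_over K {} (\<lambda>x. e (F' x)) M P"
    by (rule emb_over_comp[OF emb_over_iso[OF F'(1) K_at_mods[OF Q], of "{}"] P(3)]) auto
  have eF: "e (F' x) = F x" "F x \<in> univ N" if "x \<in> univ U" for x
  proof -
    have "F x \<in> univ W" using struct_isoD(5)[OF F] that by blast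
    then show "e (F' x) = F x" "F x \<in> univ N"
      using F'(3) P(3) that le_univ[OF U(4)] by (auto simp: emb_over_def)
  qed
  obtain A B f where *: "le K M A" "le K A M'" "le K N B" "le K B N'" "struct_iso V f A B"
    "\<forall>x\<in>univ M. e (F' x) \<in> univ N \<longrightarrow> f x = e (F' x)"
    using back_and_forth_step[OF M N P(1,2) w] by blast
  have "f x = F x" if "x \<in> univ U" for x
    using *(6) eF[OF that] subsetD[OF le_univ[OF U(3)] that] by simp
  then show ?thesis using * by blast
qed

text \<open>The chains need not be continuous, so the isomorphisms are built between models squeezed
  between a stage and its successor. The union of the earlier domains lies below \<open>M j\<close>,
  though it may differ from it, and the partial isomorphism is extended from there.\<close>

lemma limit_unique:
  assumes d: "limit_ord d" "|Field d| \<le>o l"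
    and M: "increasing (le_u K l) d M" and N: "increasing (le_u K l) d N"
  shows "isomorphic V (union_struct V (Field d) M) (union_struct V (Field d) N)"
proof -
  have wd: "Well_order d" and ne: "Field d \<noteq> {}" using d(1) by (auto simp: limit_ord_def)
  let ?s = "ord_suc d"
  note s = ord_suc_props[OF d(1)]
  have uM: "le_u K l (M j) (M (?s j))" and uN: "le_u K l (N j) (N (?s j))" if "j \<in> Field d" for j
    using M N s[OF that] unfolding increasing_def by blast+
  have leM: "le K (M i) (M j)" and leN: "le K (N i) (N j)" if "(i, j) \<in> d" for i j
  proof -
    have i: "i \<in> Field d" using that by (auto simp: Field_def)
    show "le K (M i) (M j)" "le K (N i) (N j)"
      using that M N le_refl K_at_mods le_uD(1)[OF uM[OF i]] le_uD(1)[OF uN[OF i]] le_uD(3)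
      unfolding increasing_def by (cases "i = j"; blast)+
  qed
  \<comment> \<open>\<open>X\<close> packs \<open>(A, B, f)\<close>. The upper bounds by the
    successor stage make these models increasing in \<open>j\<close>.\<close>
  define good where "good j X \<longleftrightarrow> le K (M j) (fst X) \<and> le K (fst X) (M (?s j)) \<and>
     le K (N j) (fst (snd X)) \<and> le K (fst (snd X)) (N (?s j)) \<and>
     struct_iso V (snd (snd X)) (fst X) (fst (snd X))" for j and X :: "('s, 'a) struct \<times> ('s, 'a) struct \<times> ('a \<Rightarrow> 'a)"
  have good_K: "fst X \<in> K_at K l" "fst (snd X) \<in> K_at K l" if "good j X" "j \<in> Field d" for j X
    using that K_at_between le_uD(1,2) uM uN unfolding good_def by blast+
  have good_le: "le K (fst X) (fst Y)" "le K (fst (snd X)) (fst (snd Y))"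
    if "good i X" "good j Y" "(i, j) \<in> d" "i \<noteq> j" for i j X Y
  proof -
    have "(?s i, j) \<in> d" using s(4)[OF _ that(3,4)] that(3) by (auto simp: Field_def)
    then show "le K (fst X) (fst Y)" "le K (fst (snd X)) (fst (snd Y))"
      using that(1,2) leM[of "?s i" j] leN[of "?s i" j] le_trans unfolding good_def by metis+
  qed
  let ?P = "\<lambda>j h X. good j X \<and> (\<forall>i\<in>underS d j. \<forall>x\<in>univ (fst (h i)). snd (snd X) x = snd (snd (h i)) x)"
  have "\<exists>h. \<forall>j\<in>Field d. ?P j h (h j)"
  proof (rule transfinite_choice[OF wd])
    fix j h assume j: "j \<in> Field d" and IH: "\<And>i. i \<in> underS d j \<Longrightarrow> ?P i h (h i)"
    have jd: "(i, j) \<in> d" "i \<noteq> j" "i \<in> Field d" if "i \<in> underS d j" for i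
      using that by (auto simp: underS_def Field_def)
    show "\<exists>X. ?P j h X"
    proof (cases "underS d j = {}")
      case True
      \<comment> \<open>At the least index there is no map to extend; joint embedding supplies a
        starting one.\<close>
      obtain P g where P: "P \<in> K_at K l" "le K (N j) P" "emb_over K {} g (M j) P"
        using joint_embedding[OF le_uD(1)[OF uN[OF j]] le_uD(1)[OF uM[OF j]]] by blast
      obtain A B f where "le K (M j) A" "le K A (M (?s j))" "le K (N j) B" "le K B (N (?s j))" "struct_iso V f A B"
        using back_and_forth_step[OF uM[OF j] uN[OF j] P] by blast
      then show ?thesis unfolding True good_def by (intro exI[of _ "(A, B, f)"]) simp
    next
      case False
      let ?A = "\<lambda>i. fst (h i)" and ?B = "\<lambda>i. fst (snd (h i))"
      have g: "good i (h i)" if "i \<in> underS d j" for i using IH[OF that] by blast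
      have inc: "le K (?A i) (?A k)" "le K (?B i) (?B k)" if "i \<in> underS d k" "k \<in> underS d j" for i k
      proof -
        have ik: "(i, k) \<in> d" "i \<noteq> k" using that(1) by (auto simp: underS_def)
        have "i \<in> underS d j" using ik that(2) Well_order_trans[OF wd] Well_order_antisym[OF wd]
          unfolding underS_def by blast
        then show "le K (?A i) (?A k)" "le K (?B i) (?B k)" using good_le[OF g g[OF that(2)] ik] by auto
      qed
      have KA: "?A i \<in> K_at K l" "?B i \<in> K_at K l" if "i \<in> underS d j" for i
        using good_K[OF g[OF that] jd(3)[OF that]] by auto
      obtain U where U: "U \<in> K_at K l" "univ U = (\<Union>i\<in>underS d j. univ (?A i))" "\<forall>i\<in>underS d j. le K (?A i) U"
        "\<forall>N. (\<forall>i\<in>underS d j. le K (?A i) N) \<longrightarrow> le K U N"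
        using segment_union[where M = ?A, OF wd d(2) False KA(1) inc(1)] by blast
      obtain W where W: "W \<in> K_at K l" "univ W = (\<Union>i\<in>underS d j. univ (?B i))" "\<forall>i\<in>underS d j. le K (?B i) W"
        "\<forall>N. (\<forall>i\<in>underS d j. le K (?B i) N) \<longrightarrow> le K W N"
        using segment_union[where M = ?B, OF wd d(2) False KA(2) inc(2)] by blast
      note r = Restr_underS[OF wd, of j]
      have "\<exists>F. struct_iso V F U W \<and> (\<forall>i\<in>Field (Restr d (underS d j)). \<forall>x\<in>univ (?A i). F x = snd (snd (h i)) x)"
      proof (rule struct_iso_glue[OF r(1)])
        show "struct_iso V (snd (snd (h i))) (?A i) (?B i)" if "i \<in> Field (Restr d (underS d j))" for i
          using g[of i] that unfolding r(2) good_def by blast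
        show "snd (snd (h k)) x = snd (snd (h i)) x" if "(i, k) \<in> Restr d (underS d j)" "x \<in> univ (?A i)" for i k x
          using IH[of k] that by (cases "i = k") (auto simp: underS_def)
        show "univ (?A i) \<subseteq> univ (?A k)" if "(i, k) \<in> Restr d (underS d j)" for i k
          using le_univ[OF inc(1)[of i k]] that by (cases "i = k") (auto simp: underS_def)
      qed (use False U(2,3) W(2,3) leD(3) in \<open>auto simp: r(2)\<close>)
      then obtain F where F: "struct_iso V F U W" "\<forall>i\<in>underS d j. \<forall>x\<in>univ (?A i). F x = snd (snd (h i)) x"
        unfolding r(2) by blast
      have "le K (?A i) (M j)" "le K (?B i) (N j)" if "i \<in> underS d j" for i
      proof -
        have "(?s i, j) \<in> d" using s(4)[OF jd(3)[OF that] jd(1,2)[OF that]] .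
        then show "le K (?A i) (M j)" "le K (?B i) (N j)"
          using g[OF that] leM leN le_trans unfolding good_def by blast+
      qed
      then have "le K U (M j)" "le K W (N j)" using U(4) W(4) by blast+
      then obtain A B f where *: "le K (M j) A" "le K A (M (?s j))" "le K (N j) B" "le K B (N (?s j))"
          "struct_iso V f A B" "\<forall>x\<in>univ U. f x = F x"
        using back_and_forth_extend[OF uM[OF j] uN[OF j] U(1) W(1) _ _ F(1)] by blast
      have "f x = snd (snd (h i)) x" if "i \<in> underS d j" "x \<in> univ (?A i)" for i x
        using F(2) *(6) that U(2) by auto
      then show ?thesis using * unfolding good_def by (intro exI[of _ "(A, B, f)"]) simp
    qed
  qed simp
  then obtain h where h: "\<And>j. j \<in> Field d \<Longrightarrow> ?P j h (h j)" by blast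
  let ?A = "\<lambda>i. fst (h i)" and ?B = "\<lambda>i. fst (snd (h i))"
  let ?UM = "union_struct V (Field d) M" and ?UN = "union_struct V (Field d) N"
  have g: "good i (h i)" if "i \<in> Field d" for i using h[OF that] by blast
  have lim: "\<And>i. i \<in> Field d \<Longrightarrow> le K (M i) ?UM" "\<And>i. i \<in> Field d \<Longrightarrow> le K (N i) ?UN"
  proof -
    have "increasing (le K) d M" "increasing (le K) d N" using M N le_uD(3) unfolding increasing_def by blast+
    moreover have "\<forall>i\<in>Field d. M i \<in> mods K" "\<forall>i\<in>Field d. N i \<in> mods K"
      using uM uN le_uD(1) K_at_mods by blast+
    ultimately show "\<And>i. i \<in> Field d \<Longrightarrow> le K (M i) ?UM" "\<And>i. i \<in> Field d \<Longrightarrow> le K (N i) ?UN"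
      using limit_union(2)[OF d(1)] by blast+
  qed
  have sub: "le K (?A i) ?UM" "le K (?B i) ?UN" "univ (M i) \<subseteq> univ (?A i)" "univ (N i) \<subseteq> univ (?B i)"
    if "i \<in> Field d" for i
    using g[OF that] lim[OF s(1)[OF that]] le_trans le_univ unfolding good_def by blast+
  have "\<exists>F. struct_iso V F ?UM ?UN \<and> (\<forall>i\<in>Field d. \<forall>x\<in>univ (?A i). F x = snd (snd (h i)) x)"
  proof (rule struct_iso_glue[OF wd ne])
    show "struct_iso V (snd (snd (h i))) (?A i) (?B i)" if "i \<in> Field d" for i
      using g[OF that] unfolding good_def by blast
    show "snd (snd (h k)) x = snd (snd (h i)) x" if "(i, k) \<in> d" "x \<in> univ (?A i)" for i k x
      using h[of k] that by (cases "i = k") (auto simp: underS_def Field_def)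
    show "univ (?A i) \<subseteq> univ (?A k)" if "(i, k) \<in> d" for i k
    proof (cases "i = k")
      case False
      have "i \<in> Field d" "k \<in> Field d" using that by (auto simp: Field_def)
      then show ?thesis using le_univ[OF good_le(1)[OF g g that False]] by blast
    qed simp
    show "univ ?UM = (\<Union>i\<in>Field d. univ (?A i))"
    proof
      show "univ ?UM \<subseteq> (\<Union>i\<in>Field d. univ (?A i))"
        unfolding univ_union_struct by (rule UN_mono[OF subset_refl sub(3)])
    qed (rule UN_least[OF le_univ[OF sub(1)]])
    show "univ ?UN = (\<Union>i\<in>Field d. univ (?B i))"
    proof
      show "univ ?UN \<subseteq> (\<Union>i\<in>Field d. univ (?B i))"
        unfolding univ_union_struct by (rule UN_mono[OF subset_refl sub(4)])
    qed (rule UN_least[OF le_univ[OF sub(2)]])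
  qed (rule leD(3)[OF sub(1)], assumption, rule leD(3)[OF sub(2)])
  then show ?thesis unfolding isomorphic_def by blast
qed

end

section \<open>Splitting of forking types\<close>

locale indep_at = aec_ap K l for K :: "('s, 'a) aec" and l :: "'a rel" +
  fixes I :: "('s, 'a) indep" and \<kappa> :: "'a rel"
  assumes indep: "independence_relation K l I" and uniqueness: "has_uniqueness K l I"
    and extension: "has_extension K l I" and continuity: "universal_continuity K l I"
    and regular_kappa: "regular_cardinal \<kappa>" and kappa_leq: "\<kappa> \<le>o l"
    and local_char: "geq_local_character K l I \<kappa>" and tame: "tame K natLeq"
begin

section \<open>Nonforking of Galois types\<close>

lemma indepD:
  assumes "I M0 a M N"
  shows "M0 \<in> K_at K l" "M \<in> K_at K l" "N \<in> K_at K l" "le K M0 M" "le K M N" "a \<in> univ N"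
proof -
  have "M0 \<in> K_at K l \<and> M \<in> K_at K l \<and> N \<in> K_at K l \<and> le K M0 M \<and> le K M N \<and> a \<in> univ N"
    using indep[unfolded independence_relation_def, THEN conjunct1] assms by blast
  then show "M0 \<in> K_at K l" "M \<in> K_at K l" "N \<in> K_at K l" "le K M0 M" "le K M N" "a \<in> univ N"
    by simp_all
qed

lemma indep_iso:
  "I M0 a M N \<Longrightarrow> struct_iso V f N N' \<Longrightarrow> struct_iso V f M M' \<Longrightarrow> struct_iso V f M0 M0' \<Longrightarrow> I M0' (f a) M' N'"
  using indep[unfolded independence_relation_def, THEN conjunct2, THEN conjunct1] by blast

lemma indep_mono: "I M0 a M N \<Longrightarrow> le K M0 M1 \<Longrightarrow> le K M1 M \<Longrightarrow> I M0 a M1 N"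
  using indep[unfolded independence_relation_def, THEN conjunct2, THEN conjunct2, THEN conjunct1] by blast

lemma indep_base_mono: "I M0 a M N \<Longrightarrow> le K M0 M1 \<Longrightarrow> le K M1 M \<Longrightarrow> I M1 a M N"
  using indep[unfolded independence_relation_def, THEN conjunct2, THEN conjunct2, THEN conjunct2,
      THEN conjunct2, THEN conjunct2] by blast

lemma nonfork_unique:
  "M \<in> K_at K l \<Longrightarrow> N \<in> K_at K l \<Longrightarrow> le K M N \<Longrightarrow> p \<in> gS K N \<Longrightarrow> q \<in> gS K N \<Longrightarrow>
    nonfork K I p N M \<Longrightarrow> nonfork K I q N M \<Longrightarrow> gres K p (univ M) = gres K q (univ M) \<Longrightarrow> p = q"
  using uniqueness unfolding has_uniqueness_def by blast

lemma nonfork_obtain: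
  assumes "nonfork K I p M M0"
  obtains a N where "p = gtp K a (univ M) N" "I M0 a M N" "triple a (univ M) N"
proof -
  obtain a N where *: "p = gtp K a (univ M) N" "I M0 a M N" using assms unfolding nonfork_def by blast
  then show ?thesis using that triple_le[OF indepD(5,6)[OF *(2)] subset_refl] by blast
qed

text \<open>\<open>nonfork\<close> provides independence only for some representative, so the
  equality of types has to be restricted along with it.\<close>

lemma nonfork_mono:
  assumes "nonfork K I (gtp K a (univ M2) N) M2 M0" "le K M0 M1" "le K M1 M2" "le K M2 N" "a \<in> univ N"
  shows "nonfork K I (gtp K a (univ M1) N) M1 M0"
proof -
  obtain c Q where c: "gtp K a (univ M2) N = gtp K c (univ M2) Q" "I M0 c M2 Q"
    using nonfork_obtain[OF assms(1)] by metis
  have "triple a (univ M2) N" using triple_le assms(4,5) by blast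
  then have "gtp K a (univ M1) N = gtp K c (univ M1) Q" using gtp_mono c(1) le_univ[OF assms(3)] by blast
  then show ?thesis using indep_mono[OF c(2) assms(2,3)] unfolding nonfork_def by blast
qed

text \<open>Makes local character at \<open>\<kappa>\<close> usable between two members of a chain
  of any length: a \<open>\<kappa>\<close>-chain is built over \<open>M\<close>, and its union
  embeds into \<open>M'\<close> over \<open>M\<close> by universality.\<close>

lemma limit_interpolant:
  assumes ue: "\<And>M. M \<in> K_at K l \<Longrightarrow> \<exists>M'. le_u K l M M'" and u: "le_u K l M M'"
  shows "\<exists>Z Y. u_chain K l \<kappa> Z Y \<and> (\<forall>k\<in>Field \<kappa>. le K M (Z k)) \<and> le K Y M'"
proof -
  have lim: "limit_ord \<kappa>" using regular_cardinal_limit_ord[OF regular_kappa] .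
  have wk: "Well_order \<kappa>" and ne: "Field \<kappa> \<noteq> {}" using lim by (auto simp: limit_ord_def)
  have "|Field \<kappa>| =o \<kappa>" using regular_kappa card_of_Field_ordIso by (auto simp: regular_cardinal_def)
  then have fk: "|Field \<kappa>| \<le>o l" using kappa_leq ordIso_ordLeq_trans by blast
  obtain Z where Z: "\<forall>k\<in>Field \<kappa>. le_u K l M (Z k)" "increasing (le_u K l) \<kappa> Z"
    using u_chain_exists[OF ue wk fk le_uD(1)[OF u]] by blast
  have ZK: "Z k \<in> K_at K l" if "k \<in> Field \<kappa>" for k using Z(1) that le_uD(2) by blast
  let ?U = "union_struct V (Field \<kappa>) Z"
  have incZ: "increasing (le K) \<kappa> Z" using Z(2) le_uD(3) unfolding increasing_def by blast
  have "\<forall>k\<in>Field \<kappa>. Z k \<in> mods K" using ZK K_at_mods by blast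
  note U = limit_union[OF lim this incZ]
  have UK: "?U \<in> K_at K l" by (rule union_K_at[OF ne fk ZK U(1) univ_union_struct])
  obtain k0 where k0: "k0 \<in> Field \<kappa>" using ne by blast
  have MU: "le K M ?U" using le_trans[OF le_uD(3) U(2)] Z(1) k0 by blast
  obtain e Y where Y: "struct_iso V e ?U Y" "le K Y M'" and e: "\<forall>x\<in>univ M. e x = x"
    using le_uD(4)[OF u UK MU] unfolding emb_over_def by blast
  have "\<forall>k\<in>Field \<kappa>. \<exists>Z'. struct_iso V e (Z k) Z' \<and> le K Z' Y" using le_image[OF U(2) Y(1)] by blast
  then obtain Z' where Z': "\<And>k. k \<in> Field \<kappa> \<Longrightarrow> struct_iso V e (Z k) (Z' k)"
    "\<And>k. k \<in> Field \<kappa> \<Longrightarrow> le K (Z' k) Y" by metis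
  have inc: "increasing (le_u K l) \<kappa> Z'" unfolding increasing_def
  proof (intro allI impI)
    fix i j assume ij: "(i, j) \<in> \<kappa> \<and> i \<noteq> j"
    then have "i \<in> Field \<kappa>" "j \<in> Field \<kappa>" by (auto simp: Field_def)
    then show "le_u K l (Z' i) (Z' j)" using ij le_u_iso Z' Z(2) unfolding increasing_def by blast
  qed
  have Z'K: "Z' k \<in> K_at K l" if "k \<in> Field \<kappa>" for k using K_at_iso[OF Z'(1) ZK] that by blast
  have "\<forall>k\<in>Field \<kappa>. Z' k \<in> mods K" using Z'K K_at_mods by blast
  moreover have "increasing (le K) \<kappa> Z'" using inc le_uD(3) unfolding increasing_def by blast
  ultimately have UY: "le K (union_struct V (Field \<kappa>) Z') Y" using limit_union(3)[OF lim] Z'(2) by blast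
  have "univ Y = e ` univ ?U" using struct_isoD(5)[OF Y(1)] by simp
  also have "\<dots> = (\<Union>k\<in>Field \<kappa>. e ` univ (Z k))" unfolding univ_union_struct by blast
  also have "\<dots> = (\<Union>k\<in>Field \<kappa>. univ (Z' k))" using struct_isoD(5)[OF Z'(1)] by simp
  finally have "union_struct V (Field \<kappa>) Z' = Y"
    using le_univ_eq[OF UY le_refl[OF leD(1)[OF Y(2)]]] by (simp add: univ_union_struct)
  moreover have "Y \<in> K_at K l" using K_at_iso[OF Y(1) UK] .
  ultimately have "u_chain K l \<kappa> Z' Y" unfolding u_chain_def using Z'K inc by auto
  moreover have "le K M (Z' k)" if k: "k \<in> Field \<kappa>" for k
  proof -
    have MZ: "le K M (Z k)" using Z(1) k le_uD(3) by blast
    have "struct_iso V e M M" using struct_iso_cong[OF struct_iso_id[OF mods_struct[OF leD(1)[OF MZ]]]] e by simp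
    then show ?thesis using le_iso[OF MZ Z'(1)[OF k]] by blast
  qed
  ultimately show ?thesis using Y(2) by blast
qed

text \<open>Tameness in contrapositive form. Models in \<open>K_at K l\<close> meet the size
  restriction of \<open>less_tame\<close>, and sizes below \<open>cardSuc natLeq\<close> are the
  countable ones.\<close>

lemma countable_tameness:
  assumes M: "M \<in> K_at K l" and a: "le K M N" "a \<in> univ N" and b: "le K M P" "b \<in> univ P"
    and ne: "gtp K a (univ M) N \<noteq> gtp K b (univ M) P"
  shows "\<exists>D. D \<subseteq> univ M \<and> |D| \<le>o natLeq \<and> gtp K a D N \<noteq> gtp K b D P"
proof -
  have S: "gtp K a (univ M) N \<in> gS K M" "gtp K b (univ M) P \<in> gS K M" using a b unfolding gS_def by blast+
  have T: "\<forall>p\<in>gS K M. \<forall>q\<in>gS K M.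
      (\<forall>A. A \<subseteq> univ M \<and> |A| <o cardSuc natLeq \<longrightarrow> gres K p A = gres K q A) \<longrightarrow> p = q"
    using tame K_at_mods[OF M] K_at_small[OF M] unfolding tame_def less_tame_def by blast
  have "\<not> (\<forall>A. A \<subseteq> univ M \<and> |A| <o cardSuc natLeq \<longrightarrow>
      gres K (gtp K a (univ M) N) A = gres K (gtp K b (univ M) P) A)"
    by (rule notI) (rule notE[OF ne mp[OF bspec[OF bspec[OF T S(1)] S(2)]]])
  then obtain D where D: "D \<subseteq> univ M" "|D| <o cardSuc natLeq"
    "gres K (gtp K a (univ M) N) D \<noteq> gres K (gtp K b (univ M) P) D"
    by auto
  have "|D| \<le>o natLeq"
    using D(2) cardSuc_ordLeq_ordLess[OF natLeq_Card_order card_of_Card_order] by blast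
  moreover have "gtp K a D N \<noteq> gtp K b D P"
    using D(3) gres_gtp[OF triple_le[OF a subset_refl] D(1)] gres_gtp[OF triple_le[OF b subset_refl] D(1)] by simp
  ultimately show ?thesis using D(1) by blast
qed

text \<open>Let \<open>Y\<close> be a limit model between \<open>M0\<close> and \<open>M1\<close>, and \<open>Z k\<close> a member of its chain over which the
  restriction of the type to \<open>Y\<close> does not fork. If the type did not split over \<open>Z k\<close>, it would be
  equal to the nonforking extension of this restriction, since \<open>Y\<close> is universal over \<open>Z k\<close>. Elements
  of \<open>M0\<close> are fixed by the isomorphism that witnesses the splitting, so they cannot realize the
  type on a set where tameness detects it.\<close>

lemma forking_witness:
  assumes ue: "\<And>M. M \<in> K_at K l \<Longrightarrow> \<exists>M'. le_u K l M M'"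
    and u: "le_u K l M0 M1" and M12: "le K M1 M2" "M2 \<in> K_at K l"
    and a: "le K M2 N" "a \<in> univ N"
    and fork: "\<not> nonfork K I (gtp K a (univ M2) N) M2 M1"
  shows "\<exists>B \<subseteq> univ M2. |B| \<le>o natLeq \<and> (\<forall>b\<in>univ M0. gtp K b B M2 \<noteq> gtp K a B N)"
proof -
  obtain Z Y where Z: "u_chain K l \<kappa> Z Y" "\<forall>k\<in>Field \<kappa>. le K M0 (Z k)" "le K Y M1"
    using limit_interpolant[OF ue u] by blast
  have YM2: "le K Y M2" using le_trans Z(3) M12(1) by blast
  have YN: "le K Y N" using le_trans YM2 a(1) by blast
  have YK: "Y \<in> K_at K l" and ZK: "\<And>k. k \<in> Field \<kappa> \<Longrightarrow> Z k \<in> K_at K l"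
    and incZ: "increasing (le_u K l) \<kappa> Z" and Yeq: "Y = union_struct V (Field \<kappa>) Z"
    using Z(1) unfolding u_chain_def by auto
  have lim: "limit_ord \<kappa>" using regular_cardinal_limit_ord[OF regular_kappa] .
  have "\<kappa> \<le>o \<kappa>" using lim by (simp add: limit_ord_def ordLeq_reflexive)
  then have lc: "local_character K l I \<kappa>"
    using local_char regular_kappa unfolding geq_local_character_def by blast
  have "gtp K a (univ Y) N \<in> gS K Y" using YN a(2) unfolding gS_def by blast
  \<comment> \<open>Write p for the type of \<open>a\<close> over \<open>M2\<close>. Local character
    applies to the restriction of p to \<open>Y\<close>, the union of a
    \<open>\<kappa>\<close>-chain.\<close>
  then obtain k where k: "k \<in> Field \<kappa>" "nonfork K I (gtp K a (univ Y) N) Y (Z k)"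
    using lc Z(1) unfolding local_character_def by blast
  have ZY: "le_u K l (Z k) Y"
  proof -
    note s = ord_suc_props[OF lim k(1)]
    have "increasing (le K) \<kappa> Z" using incZ le_uD(3) unfolding increasing_def by blast
    moreover have "\<forall>k\<in>Field \<kappa>. Z k \<in> mods K" using ZK K_at_mods by blast
    ultimately have "le K (Z (ord_suc \<kappa> k)) Y" using limit_union(2)[OF lim] s(1) Yeq by blast
    moreover have "le_u K l (Z k) (Z (ord_suc \<kappa> k))" using incZ s(2,3) unfolding increasing_def by blast
    ultimately show ?thesis using le_u_trans2 YK by blast
  qed
  have ZM1: "le K (Z k) M1" and ZM2: "le K (Z k) M2" using le_trans le_uD(3)[OF ZY] Z(3) M12(1) by blast+
  obtain q where q: "q \<in> gS K M2" "gres K q (univ Y) = gtp K a (univ Y) N" "nonfork K I q M2 (Z k)"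
    using extension[unfolded has_extension_def, rule_format, OF ZK[OF k(1)] YK M12(2) _ _ k(2)]
      le_uD(3)[OF ZY] YM2 \<open>gtp K a (univ Y) N \<in> gS K Y\<close> by blast
  obtain c Q where c: "q = gtp K c (univ M2) Q" "I (Z k) c M2 Q" "triple c (univ M2) Q"
    using nonfork_obtain[OF q(3)] by blast
  note cQ = indepD(5,6)[OF c(2)]
  have cY: "gtp K c (univ Y) Q = gtp K a (univ Y) N"
    using q(2) gres_gtp[OF c(3) le_univ[OF YM2]] c(1) by simp
  \<comment> \<open>If q were p, then p would not fork over \<open>Z k\<close>, hence by base
    monotonicity not over \<open>M1\<close>.\<close>
  have neq: "gtp K c (univ M2) Q \<noteq> gtp K a (univ M2) N"
    using fork indep_base_mono[OF c(2) ZM1 M12(1)] unfolding nonfork_def by metis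
  \<comment> \<open>The splitting isomorphism: \<open>Y\<close> is universal over
    \<open>Z k\<close>, so it contains a copy \<open>N2\<close> of \<open>M2\<close>. On
    \<open>N2\<close> the types p and q agree.\<close>
  obtain f N2 where f: "struct_iso V f M2 N2" "le K N2 Y" "\<forall>x\<in>univ (Z k). f x = x"
    using le_uD(4)[OF ZY M12(2) ZM2] unfolding emb_over_def by blast
  have N2K: "N2 \<in> K_at K l" using K_at_iso[OF f(1) M12(2)] .
  have N2M2: "le K N2 M2" using le_trans f(2) YM2 by blast
  have N2N: "le K N2 N" and N2Q: "le K N2 Q" using le_trans N2M2 a(1) cQ(1) by blast+
  have fZ: "struct_iso V f (Z k) (Z k)"
    using struct_iso_cong[OF struct_iso_id[OF mods_struct[OF leD(1)[OF ZM1]]]] f(3) by simp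
  have ZN2: "le K (Z k) N2" using le_iso[OF ZM2 f(1) fZ] .
  \<comment> \<open>\<open>F a\<close> realizes the image f(p) over \<open>N2\<close>, and
    \<open>H c\<close> below realizes f(q).\<close>
  obtain N' F where F: "struct_iso V F N N'" "le K N2 N'" "\<forall>x\<in>univ M2. F x = f x"
    using iso_extend[OF f(1) a(1) K_at_small[OF N2K]] by blast
  obtain Q' H where H: "struct_iso V H Q Q'" "le K N2 Q'" "\<forall>x\<in>univ M2. H x = f x"
    using iso_extend[OF f(1) cQ(1) K_at_small[OF N2K]] by blast
  have Fa: "F a \<in> univ N'" using struct_isoD(5)[OF F(1)] a(2) by blast
  have Hc: "H c \<in> univ Q'" using struct_isoD(5)[OF H(1)] cQ(2) by blast
  have HZ: "\<forall>x\<in>univ (Z k). H x = x" using H(3) f(3) le_univ[OF ZM2] by auto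
  \<comment> \<open>Both f(q) and the restriction of q to \<open>N2\<close> do not fork over
    \<open>Z k\<close> and agree there, so uniqueness identifies them.\<close>
  have nosplit: "gtp K (H c) (univ N2) Q' = gtp K c (univ N2) Q"
  proof (rule nonfork_unique[OF ZK[OF k(1)] N2K ZN2])
    show "gtp K (H c) (univ N2) Q' \<in> gS K N2" "gtp K c (univ N2) Q \<in> gS K N2"
      using H(2) Hc N2Q cQ(2) unfolding gS_def by blast+
    have "struct_iso V H M2 N2" using struct_iso_cong[OF f(1)] H(3) by simp
    moreover have "struct_iso V H (Z k) (Z k)"
      using struct_iso_cong[OF struct_iso_id[OF mods_struct[OF leD(1)[OF ZM1]]]] HZ by simp
    ultimately show "nonfork K I (gtp K (H c) (univ N2) Q') N2 (Z k)"
      using indep_iso[OF c(2) H(1)] unfolding nonfork_def by blast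
    show "nonfork K I (gtp K c (univ N2) Q) N2 (Z k)"
      using indep_mono[OF c(2) ZN2 N2M2] unfolding nonfork_def by blast
    have "gres K (gtp K (H c) (univ N2) Q') (univ (Z k)) = gtp K (H c) (univ (Z k)) Q'"
      by (rule gres_gtp[OF triple_le[OF H(2) Hc subset_refl] le_univ[OF ZN2]])
    also have "\<dots> = gtp K c (univ (Z k)) Q"
    proof (rule gtp_emb[symmetric])
      show "triple c (univ (Z k)) Q" by (rule triple_le[OF cQ le_univ[OF ZM2]])
      show "emb_over K (univ (Z k)) H Q Q'" using emb_over_iso[OF H(1) leD(2)[OF H(2)]] HZ by blast
    qed
    also have "\<dots> = gres K (gtp K c (univ N2) Q) (univ (Z k))"
      by (rule gres_gtp[OF triple_le[OF N2Q cQ(2) subset_refl] le_univ[OF ZN2], symmetric])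
    finally show "gres K (gtp K (H c) (univ N2) Q') (univ (Z k)) = gres K (gtp K c (univ N2) Q) (univ (Z k))" .
  qed
  have cN2: "gtp K c (univ N2) Q = gtp K a (univ N2) N"
    by (rule gtp_mono[OF triple_le[OF _ cQ(2) subset_refl] cY le_univ[OF f(2)]])
      (rule le_trans[OF YM2 cQ(1)])
  obtain g where g: "struct_iso V g N2 M2" "\<forall>x\<in>univ M2. g (f x) = x" "\<forall>y\<in>univ N2. f (g y) = y"
    using struct_iso_inv[OF f(1)] by blast
  have gN2: "g ` univ N2 = univ M2" using struct_isoD(5)[OF g(1)] .
  \<comment> \<open>Otherwise f(p), the restriction of p, that of q and f(q) would all coincide over
    \<open>N2\<close>, and pulling back along \<open>f\<close> would give p = q.\<close>
  have split: "gtp K (F a) (univ N2) N' \<noteq> gtp K a (univ N2) N"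
  proof
    assume "gtp K (F a) (univ N2) N' = gtp K a (univ N2) N"
    then have eq: "gtp K (H c) (univ N2) Q' = gtp K (F a) (univ N2) N'" using nosplit cN2 by simp
    obtain F' where F': "struct_iso V F' N' N" "\<forall>x\<in>univ N. F' (F x) = x"
      using struct_iso_inv[OF F(1)] by blast
    obtain H' where H': "struct_iso V H' Q' Q" "\<forall>x\<in>univ Q. H' (H x) = x"
      using struct_iso_inv[OF H(1)] by blast
    have *: "H' y = g y" "F' y = g y" if "y \<in> univ N2" for y
    proof -
      have gy: "g y \<in> univ M2" using gN2 that by blast
      then have "y = H (g y)" "y = F (g y)" using F(3) H(3) g(3) that by auto
      then show "H' y = g y" "F' y = g y"
        using F'(2) H'(2) subsetD[OF le_univ[OF a(1)] gy] subsetD[OF le_univ[OF cQ(1)] gy] by metis+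
    qed
    have "gtp K (H' (H c)) (g ` univ N2) Q = gtp K (F' (F a)) (g ` univ N2) N"
      by (rule gtp_transport[OF eq triple_le[OF H(2) Hc subset_refl] K_at_small[OF N2K] H'(1) _ F'(1)])
        (use * in auto)
    then show False using neq gN2 F'(2) H'(2) a(2) cQ(2) by simp
  qed
  \<comment> \<open>\<open>D\<close> is countable and separates f(p) from p. The witness must also
    contain the preimage \<open>?C\<close> of \<open>D\<close>, since f(p) on \<open>D\<close> is
    the image of p on \<open>?C\<close>.\<close>
  obtain D where D: "D \<subseteq> univ N2" "|D| \<le>o natLeq" "gtp K (F a) D N' \<noteq> gtp K a D N"
    using countable_tameness[OF N2K F(2) Fa N2N a(2) split] by blast
  let ?C = "g ` D"
  have C: "?C \<subseteq> univ M2" "f ` ?C = D" using D(1) gN2 g(3) by (auto simp: image_iff subset_iff)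
  have "|?C| \<le>o natLeq" using ordLeq_transitive[OF card_of_image D(2)] .
  then have "|?C \<union> D| \<le>o natLeq"
    using card_of_Un_ordLeq_infinite_Field[OF _ _ D(2) natLeq_Card_order]
    by (simp add: Field_natLeq)
  moreover have sub: "?C \<union> D \<subseteq> univ M2" using C(1) D(1) le_univ[OF N2M2] by blast
  \<comment> \<open>Applying \<open>f\<close> to the agreement on \<open>?C\<close>, the fixed
    element \<open>b\<close> satisfies f(p) on \<open>D\<close>; by the agreement on
    \<open>D\<close> it also satisfies p there.\<close>
  moreover have "gtp K b (?C \<union> D) M2 \<noteq> gtp K a (?C \<union> D) N" if b: "b \<in> univ M0" for b
  proof
    assume eq: "gtp K b (?C \<union> D) M2 = gtp K a (?C \<union> D) N"
    have "le K M0 (Z k)" using Z(2) k(1) by blast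
    then have bZ: "b \<in> univ (Z k)" using le_univ b by blast
    then have fb: "f b = b" "b \<in> univ N2" "b \<in> univ M2" using f(3) le_univ[OF ZN2] le_univ[OF ZM2] by auto
    have t: "triple b (?C \<union> D) M2" using sub fb(3) K_at_mods[OF M12(2)] by (simp add: triple_def)
    have eqC: "gtp K b ?C M2 = gtp K a ?C N" by (rule gtp_mono[OF t eq]) blast
    have eqD: "gtp K b D M2 = gtp K a D N" by (rule gtp_mono[OF t eq]) blast
    have tC: "triple b ?C M2" using t by (simp add: triple_def)
    have "|?C| <o |UNIV :: 'a set|"
      using ordLeq_ordLess_trans[OF card_of_mono1[OF C(1)] K_at_small[OF M12(2)]] .
    then have "gtp K (f b) (f ` ?C) N2 = gtp K (F a) (f ` ?C) N'"
      using gtp_transport[OF eqC tC _ f(1) _ F(1)] F(3) C(1) by blast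
    then have "gtp K b D N2 = gtp K (F a) D N'" using C(2) fb(1) by simp
    moreover have "triple b D N2" using fb(2) D(1) K_at_mods[OF N2K] by (simp add: triple_def)
    then have "gtp K b D N2 = gtp K b D M2" using gtp_le N2M2 by blast
    ultimately show False using eqD D(3) by simp
  qed
  ultimately show ?thesis by blast
qed

section \<open>Chains of forking types\<close>

text \<open>Both chains exhaust \<open>Mstar\<close>, but the witnesses collected along
  \<open>M\<close> form a set of size at most \<open>|Field d|\<close>, and \<open>nc\<close> makes
  such sets bounded along \<open>C\<close>. Universality of \<open>C\<close> at successors realizes
  what the witnesses exclude.\<close>

lemma forking_chain_not_saturated:
  fixes d e :: "'a rel"
  assumes ue: "\<And>M. M \<in> K_at K l \<Longrightarrow> \<exists>M'. le_u K l M M'"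
    and d: "limit_ord d" "infinite (Field d)" and M: "increasing (le_u K l) d M"
    and Mstar: "\<And>i. i \<in> Field d \<Longrightarrow> le K (M i) Mstar" "univ Mstar = (\<Union>i\<in>Field d. univ (M i))"
    and a: "le K Mstar N" "a \<in> univ N"
    and fork: "\<And>i j. (i, j) \<in> d \<Longrightarrow> i \<noteq> j \<Longrightarrow> \<not> nonfork K I (gtp K a (univ (M j)) N) (M j) (M i)"
    and e: "limit_ord e" and C: "increasing (le K) e C"
    and Cu: "\<And>j. j \<in> Field e \<Longrightarrow> le_u K l (C j) (C (ord_suc e j))"
    and Cstar: "\<And>j. j \<in> Field e \<Longrightarrow> le K (C j) Mstar" "univ Mstar = (\<Union>j\<in>Field e. univ (C j))"
    and nc: "\<And>S. S \<subseteq> Field e \<Longrightarrow> |S| \<le>o |Field d| \<Longrightarrow> \<not> cofinal S e"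
  shows False
proof -
  let ?s = "ord_suc d"
  note s = ord_suc_props[OF d(1)]
  have we: "Well_order e" using e by (simp add: limit_ord_def)
  have uM: "le_u K l (M i) (M (?s i))" if "i \<in> Field d" for i
    using M s(2,3)[OF that] unfolding increasing_def by blast
  \<comment> \<open>The witness for stage i comes from forking of stage i+2 over stage i+1; the step
    from i to i+1 makes room for the inserted limit model.\<close>
  have "\<exists>B \<subseteq> univ (M (?s (?s i))). |B| \<le>o natLeq \<and> (\<forall>b\<in>univ (M i). gtp K b B (M (?s (?s i))) \<noteq> gtp K a B N)"
    if i: "i \<in> Field d" for i
  proof -
    have i1: "?s i \<in> Field d" and i2: "?s (?s i) \<in> Field d" using s(1) i by blast+
    have "le K (M (?s (?s i))) N" using le_trans[OF Mstar(1)[OF i2] a(1)] .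
    then show ?thesis
      using forking_witness[OF ue uM[OF i] le_uD(3)[OF uM[OF i1]] le_uD(2)[OF uM[OF i1]] _ a(2)]
        fork[OF s(2,3)[OF i1]] by blast
  qed
  then obtain B where B: "\<And>i. i \<in> Field d \<Longrightarrow> B i \<subseteq> univ (M (?s (?s i)))"
    "\<And>i. i \<in> Field d \<Longrightarrow> |B i| \<le>o natLeq"
    "\<And>i b. i \<in> Field d \<Longrightarrow> b \<in> univ (M i) \<Longrightarrow> gtp K b (B i) (M (?s (?s i))) \<noteq> gtp K a (B i) N"
    by metis
  let ?B = "\<Union>i\<in>Field d. B i"
  have Bsub: "?B \<subseteq> univ Mstar"
  proof (rule UN_least)
    fix i assume "i \<in> Field d"
    then show "B i \<subseteq> univ Mstar" using B(1) le_univ[OF Mstar(1)] s(1) by blast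
  qed
  \<comment> \<open>As the index set is infinite, it absorbs the countable witnesses.\<close>
  have "natLeq \<le>o |Field d|" using d(2) infinite_iff_natLeq_ordLeq by blast
  then have "\<forall>i\<in>Field d. |B i| \<le>o |Field d|" using B(2) ordLeq_transitive by blast
  then have cB: "|?B| \<le>o |Field d|"
    using card_of_UNION_ordLeq_infinite[OF d(2) ordIso_imp_ordLeq[OF card_of_refl]] by blast
  have "\<forall>x\<in>?B. \<exists>k\<in>Field e. x \<in> univ (C k)" using Bsub Cstar(2) by blast
  then obtain k where k: "\<And>x. x \<in> ?B \<Longrightarrow> k x \<in> Field e \<and> x \<in> univ (C (k x))" by metis
  have S: "k ` ?B \<subseteq> Field e" using k by blast
  obtain j where j: "j \<in> Field e" "\<And>t. t \<in> k ` ?B \<Longrightarrow> (t, j) \<in> e"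
    using not_cofinal_bound[OF we S nc[OF S ordLeq_transitive[OF card_of_image cB]]] by blast
  have BC: "?B \<subseteq> univ (C j)"
  proof
    fix x assume x: "x \<in> ?B"
    have "(k x, j) \<in> e" using j(2) x by blast
    then have "univ (C (k x)) \<subseteq> univ (C j)"
      using C le_univ unfolding increasing_def by (cases "k x = j") blast+
    then show "x \<in> univ (C j)" using k[OF x] by blast
  qed
  have CN: "le K (C j) N" using le_trans[OF Cstar(1)[OF j(1)] a(1)] .
  \<comment> \<open>\<open>b\<close> realizes the type of \<open>a\<close> over all witnesses
    simultaneously, including the one belonging to a stage that contains \<open>b\<close>.\<close>
  obtain b where b: "b \<in> univ (C (ord_suc e j))"
    "gtp K a (univ (C j)) N = gtp K b (univ (C j)) (C (ord_suc e j))"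
    using gtp_realized[OF Cu[OF j(1)] CN a(2)] by blast
  have Csuc: "le K (C (ord_suc e j)) Mstar" using Cstar(1) ord_suc_props(1)[OF e j(1)] by blast
  have "b \<in> univ Mstar" using b(1) le_univ[OF Csuc] by blast
  then obtain i where i: "i \<in> Field d" "b \<in> univ (M i)" using Mstar(2) by blast
  have i1: "?s i \<in> Field d" and i2: "?s (?s i) \<in> Field d" using s(1) i(1) by blast+
  have bss: "b \<in> univ (M (?s (?s i)))"
    using i(2) le_univ[OF le_uD(3)[OF uM[OF i(1)]]] le_univ[OF le_uD(3)[OF uM[OF i1]]] by blast
  have Bi: "B i \<subseteq> univ (C j)" using BC i(1) by blast
  have "gtp K a (B i) N = gtp K b (B i) (C (ord_suc e j))"
    by (rule gtp_mono[OF triple_le[OF CN a(2) subset_refl] b(2) Bi])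
  also have "\<dots> = gtp K b (B i) Mstar"
    by (rule gtp_le[OF _ Csuc]) (rule triple_le[OF le_uD(3)[OF Cu[OF j(1)]] b(1) Bi])
  also have "\<dots> = gtp K b (B i) (M (?s (?s i)))"
    by (rule gtp_le[OF _ Mstar(1)[OF i2], symmetric])
      (use bss B(1)[OF i(1)] leD(1)[OF Mstar(1)[OF i2]] in \<open>simp add: triple_def\<close>)
  finally show False using B(3)[OF i] by simp
qed

text \<open>Universal continuity in contrapositive form. It concerns chains indexed by
  \<open>g\<close> and their least member, so the chain is reindexed to begin at \<open>M i\<close>
  with the same union.\<close>

lemma forking_chain_step:
  assumes g: "regular_cardinal g"
    and M: "u_chain K l g M Mg" and a: "le K Mg N" "a \<in> univ N"
    and i: "i \<in> Field g" and fork: "\<not> nonfork K I (gtp K a (univ Mg) N) Mg (M i)"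
  shows "\<exists>k\<in>Field g. (i, k) \<in> g \<and> i \<noteq> k \<and> \<not> nonfork K I (gtp K a (univ (M k)) N) (M k) (M i)"
proof (rule ccontr)
  assume "\<not> ?thesis"
  then have nf: "nonfork K I (gtp K a (univ (M k)) N) (M k) (M i)" if "k \<in> Field g" "(i, k) \<in> g" "i \<noteq> k" for k
    using that by blast
  have lim: "limit_ord g" using regular_cardinal_limit_ord[OF g] .
  have wg: "Well_order g" and ne: "Field g \<noteq> {}" using lim by (auto simp: limit_ord_def)
  have cg: "Card_order g" using g by (simp add: regular_cardinal_def)
  have MK: "\<And>j. j \<in> Field g \<Longrightarrow> M j \<in> K_at K l" and inc: "increasing (le_u K l) g M"
    and Mg: "Mg = union_struct V (Field g) M" "Mg \<in> K_at K l" using M unfolding u_chain_def by auto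
  have leM: "le K (M j) (M k)" if "(j, k) \<in> g" for j k
  proof (cases "j = k")
    case True
    have "k \<in> Field g" using that by (auto simp: Field_def)
    then show ?thesis using True le_refl MK K_at_mods by blast
  next
    case False
    then show ?thesis using that inc le_uD(3) unfolding increasing_def by blast
  qed
  have "\<forall>j\<in>Field g. M j \<in> mods K" using MK K_at_mods by blast
  moreover have "increasing (le K) g M" using leM unfolding increasing_def by blast
  ultimately have leMg: "le K (M j) Mg" if "j \<in> Field g" for j
    using limit_union(2)[OF lim] that Mg(1) by blast
  \<comment> \<open>\<open>i\<close> is prescribed at the least index; elsewhere \<open>h j\<close>
    stays above \<open>j\<close>, which keeps the union unchanged.\<close>
  let ?G = "\<lambda>j. if underS g j = {} then i else j"
  obtain h where h: "\<And>j. j \<in> Field g \<Longrightarrow> h j \<in> Field g"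
    "\<And>j. j \<in> Field g \<Longrightarrow> underS g j = {} \<Longrightarrow> h j = ?G j"
    "\<And>j. j \<in> Field g \<Longrightarrow> (?G j, h j) \<in> g"
    "\<And>j k. (j, k) \<in> g \<Longrightarrow> j \<noteq> k \<Longrightarrow> (id (h j), h k) \<in> g \<and> (h j, h k) \<in> g \<and> h j \<noteq> h k"
  proof (rule increasing_choice[of g g ?G id])
    show "\<not> cofinal S g" if "j \<in> Field g" "S \<subseteq> Field g" "|S| \<le>o |underS g j|" for j S
      using regular_not_cofinal[OF g that(2) ordLeq_ordLess_trans[OF that(3) card_of_underS[OF cg that(1)]]] .
  qed (use wg lim i in auto)
  let ?M = "\<lambda>j. M (h j)"
  note z = ord_zero_props[OF wg ne]
  have "underS g (ord_zero g) = {}"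
    using z(2) Well_order_antisym[OF wg] unfolding underS_def by (auto simp: Field_def)
  then have hz: "h (ord_zero g) = i" using h(2)[OF z(1)] by simp
  have incM: "increasing (le_u K l) g ?M" using inc h(4) unfolding increasing_def by blast
  have jh: "(j, h j) \<in> g" if j: "j \<in> Field g" for j
  proof (cases "underS g j = {}")
    case True
    then have "h j = i" using h(2)[OF j] by simp
    moreover have "(i, j) \<notin> g \<or> i = j" using True by (auto simp: underS_def)
    then have "(j, i) \<in> g" using Well_order_total[OF wg j i] Well_order_refl[OF wg j] by auto
    ultimately show ?thesis by simp
  next
    case False
    then show ?thesis using h(3)[OF j] by simp
  qed
  have UMg: "le K (union_struct V (Field g) ?M) Mg"
  proof (rule limit_union(3)[OF lim])
    show "\<forall>j\<in>Field g. ?M j \<in> mods K" using MK h(1) K_at_mods by blast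
    show "increasing (le K) g ?M" using incM le_uD(3) unfolding increasing_def by blast
  qed (use leMg h(1) in blast)
  have "univ (union_struct V (Field g) ?M) = univ Mg"
  proof
    show "univ (union_struct V (Field g) ?M) \<subseteq> univ Mg" by (rule le_univ[OF UMg])
    show "univ Mg \<subseteq> univ (union_struct V (Field g) ?M)"
      unfolding Mg(1) univ_union_struct by (rule UN_mono[OF subset_refl le_univ[OF leM[OF jh]]])
  qed
  then have "Mg = union_struct V (Field g) ?M" using le_univ_eq[OF UMg le_refl[OF K_at_mods[OF Mg(2)]]] by simp
  then have "u_chain K l g ?M Mg" unfolding u_chain_def using MK h(1) incM Mg(2) by blast
  moreover have "gtp K a (univ Mg) N \<in> gS K Mg" using a unfolding gS_def by blast
  moreover have "nonfork K I (gres K (gtp K a (univ Mg) N) (univ (?M j))) (?M j) (?M (ord_zero g))"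
    if j: "j \<in> Field g" for j
  proof -
    have hj: "h j \<in> Field g" using h(1) j .
    have "nonfork K I (gtp K a (univ (M (h j))) N) (M (h j)) (M i)"
    proof (cases "h j = i")
      case True
      \<comment> \<open>The assumption covers only stages strictly above \<open>i\<close>; at
        \<open>i\<close> itself nonforking is restricted from the next stage.\<close>
      note s = ord_suc_props[OF lim i]
      have "le K (M (ord_suc g i)) N" using le_trans[OF leMg[OF s(1)] a(1)] .
      then show ?thesis unfolding True
        using nonfork_mono[OF nf[OF s(1-3)] leM[OF Well_order_refl[OF wg i]] leM[OF s(2)] _ a(2)] by blast
    next
      case False
      have "(i, h j) \<in> g"
      proof (cases "j = ord_zero g")
        case True
        then show ?thesis using hz False by simp
      next
        case False
        then show ?thesis using h(4)[of "ord_zero g" j] z(2)[OF j] hz by auto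
      qed
      then show ?thesis using nf[OF hj] False by blast
    qed
    then show ?thesis
      unfolding hz gres_gtp[OF triple_le[OF a subset_refl] le_univ[OF leMg[OF hj]]] .
  qed
  ultimately have "nonfork K I (gtp K a (univ Mg) N) Mg (?M (ord_zero g))"
    using continuity g unfolding universal_continuity_def univ_continuity_at_def by blast
  then show False using fork hz by simp
qed

text \<open>Failure of membership in \<open>kappa_set\<close> gives a type forking over every
  member, and \<open>F\<close> localizes each instance to a later stage. Thinning past the values of
  \<open>F\<close> is possible for every cardinal \<open>m\<close> up to \<open>g\<close>, since
  proper initial segments of \<open>m\<close> are not cofinal in \<open>g\<close>. The model between
  \<open>M i\<close> and \<open>N\<close> is the union of the original chain.\<close>

lemma forking_chain_exists:
  assumes g: "regular_cardinal g" "g <o cardSuc l" "g \<notin> kappa_set K l I"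
    and m: "Card_order m" "m \<le>o g"
  shows "\<exists>M N a. (\<forall>i\<in>Field m. M i \<in> K_at K l) \<and> increasing (le_u K l) m M \<and>
    (\<forall>i\<in>Field m. \<exists>P. le K (M i) P \<and> le K P N) \<and> a \<in> univ N \<and>
    (\<forall>i j. (i, j) \<in> m \<and> i \<noteq> j \<longrightarrow> \<not> nonfork K I (gtp K a (univ (M j)) N) (M j) (M i))"
proof -
  have lim: "limit_ord g" using regular_cardinal_limit_ord[OF g(1)] .
  have wg: "Well_order g" and ne: "Field g \<noteq> {}" using lim by (auto simp: limit_ord_def)
  obtain M Mg p where M: "cont_chain K l (le_u K l) g M Mg" and p: "p \<in> gS K Mg"
    and fork: "\<forall>i\<in>Field g. \<not> nonfork K I p Mg (M i)"
    using g(2,3) wg unfolding kappa_set_def by blast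
  have uc: "u_chain K l g M Mg" using M lim unfolding cont_chain_def u_chain_def by blast
  obtain a N where a: "p = gtp K a (univ Mg) N" "le K Mg N" "a \<in> univ N" using p by (rule gS_cases)
  have "\<forall>i\<in>Field g. \<exists>k\<in>Field g. (i, k) \<in> g \<and> i \<noteq> k \<and> \<not> nonfork K I (gtp K a (univ (M k)) N) (M k) (M i)"
    using forking_chain_step[OF g(1) uc a(2,3)] fork a(1) by blast
  then obtain F where F: "\<And>i. i \<in> Field g \<Longrightarrow> F i \<in> Field g"
    "\<And>i. i \<in> Field g \<Longrightarrow> (i, F i) \<in> g \<and> i \<noteq> F i"
    "\<And>i. i \<in> Field g \<Longrightarrow> \<not> nonfork K I (gtp K a (univ (M (F i))) N) (M (F i)) (M i)" by metis
  obtain i0 where i0: "i0 \<in> Field g" using ne by blast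
  obtain h where h: "\<And>j. j \<in> Field m \<Longrightarrow> h j \<in> Field g"
    "\<And>i j. (i, j) \<in> m \<Longrightarrow> i \<noteq> j \<Longrightarrow> (F (h i), h j) \<in> g \<and> (h i, h j) \<in> g \<and> h i \<noteq> h j"
  proof (rule increasing_choice[of m g "\<lambda>_. i0" F])
    show "Well_order m" using m(1) by (simp add: card_order_on_def)
    show "\<not> cofinal S g" if "j \<in> Field m" "S \<subseteq> Field g" "|S| \<le>o |underS m j|" for j S
      using regular_not_cofinal[OF g(1) that(2)] ordLeq_ordLess_trans[OF that(3) card_of_underS[OF m(1) that(1)]]
        ordLess_ordLeq_trans m(2) by blast
  qed (use lim i0 F(1) in auto)
  have MK: "\<And>j. j \<in> Field g \<Longrightarrow> M j \<in> K_at K l" and inc: "increasing (le_u K l) g M"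
    and leMg: "\<And>j. j \<in> Field g \<Longrightarrow> le K (M j) Mg"
    using M le_uD(3) unfolding cont_chain_def by blast+
  have leM: "le K (M j) (M k)" if "(j, k) \<in> g" for j k
  proof (cases "j = k")
    case True
    have "k \<in> Field g" using that by (auto simp: Field_def)
    then show ?thesis using True le_refl MK K_at_mods by blast
  next
    case False
    then show ?thesis using that inc le_uD(3) unfolding increasing_def by blast
  qed
  have "\<not> nonfork K I (gtp K a (univ (M (h j))) N) (M (h j)) (M (h i))" if ij: "(i, j) \<in> m" "i \<noteq> j" for i j
  proof
    assume nf: "nonfork K I (gtp K a (univ (M (h j))) N) (M (h j)) (M (h i))"
    have ijF: "i \<in> Field m" "j \<in> Field m" using ij(1) by (auto simp: Field_def)
    have 1: "le K (M (h i)) (M (F (h i)))" using leM F(2)[OF h(1)[OF ijF(1)]] by blast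
    have 2: "le K (M (F (h i))) (M (h j))" using leM h(2)[OF ij] by blast
    have 3: "le K (M (h j)) N" using le_trans[OF leMg[OF h(1)[OF ijF(2)]] a(2)] .
    \<comment> \<open>Stage \<open>h j\<close> lies above stage \<open>F (h i)\<close>, so
      nonforking at \<open>h j\<close> would restrict to it.\<close>
    show False using nonfork_mono[OF nf 1 2 3 a(3)] F(3)[OF h(1)[OF ijF(1)]] by blast
  qed
  moreover have "increasing (le_u K l) m (\<lambda>j. M (h j))" using inc h(2) unfolding increasing_def by blast
  ultimately show ?thesis using MK h(1) a(2,3) leMg by (intro exI[of _ "\<lambda>j. M (h j)"] exI[of _ N] exI[of _ a]) blast
qed

text \<open>Formulated without \<open>kappa\<close>, so that it applies with the two ordinals in
  either order: only the smaller cofinality has to be at most \<open>g\<close>.\<close>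

lemma limit_models_not_isomorphic:
  assumes g: "regular_cardinal g" "g <o cardSuc l" "g \<notin> kappa_set K l I"
    and dg: "cf \<delta> \<le>o g" and de: "cf \<delta> <o cf \<epsilon>"
    and M1: "limit_model K l \<delta> M1" and M2: "limit_model K l \<epsilon> M2"
  shows "\<not> isomorphic V M1 M2"
proof
  assume iso: "isomorphic V M1 M2"
  have lim: "limit_ord \<delta>" "limit_ord \<epsilon>" "\<delta> <o cardSuc l" using M1 M2 unfolding limit_model_def by auto
  have wd: "Well_order \<delta>" using lim(1) by (simp add: limit_ord_def)
  let ?m = "cf \<delta>"
  have reg: "regular_cardinal ?m" using cf_regular[OF lim(1)] .
  then have m: "Card_order ?m" "infinite (Field ?m)" by (auto simp: regular_cardinal_def cinfinite_def)
  have limm: "limit_ord ?m" using regular_cardinal_limit_ord[OF reg] .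
  have ne: "Field ?m \<noteq> {}" using m(2) by auto
  have fm: "|Field ?m| =o ?m" using card_of_Field_ordIso[OF m(1)] .
  have fml: "|Field ?m| \<le>o l" using ordIso_ordLeq_trans[OF fm cf_leq(1)[OF lim(1) Card_order_l lim(3)]] .
  obtain M N a where MK: "\<And>i. i \<in> Field ?m \<Longrightarrow> M i \<in> K_at K l" and inc: "increasing (le_u K l) ?m M"
    and MN: "\<And>i. i \<in> Field ?m \<Longrightarrow> le K (M i) N" and a: "a \<in> univ N"
    and fork: "\<And>i j. (i, j) \<in> ?m \<Longrightarrow> i \<noteq> j \<Longrightarrow> \<not> nonfork K I (gtp K a (univ (M j)) N) (M j) (M i)"
    using forking_chain_exists[OF g m(1) dg] le_trans by metis
  let ?U = "union_struct V (Field ?m) M"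
  have Mm: "\<forall>i\<in>Field ?m. M i \<in> mods K" using MK K_at_mods by blast
  have "increasing (le K) ?m M" using inc le_uD(3) unfolding increasing_def by blast
  note U = limit_union[OF limm Mm this]
  \<comment> \<open>Three consecutive members of the forking chain supply the two universal
    steps.\<close>
  have ue: "\<exists>M'. le_u K l X M'" if "X \<in> K_at K l" for X
  proof -
    obtain i where i: "i \<in> Field ?m" using ne by blast
    note s = ord_suc_props[OF limm]
    have "le_u K l (M i) (M (ord_suc ?m i))"
      "le_u K l (M (ord_suc ?m i)) (M (ord_suc ?m (ord_suc ?m i)))"
      using inc s(2,3)[OF i] s(2,3)[OF s(1)[OF i]] unfolding increasing_def by blast+
    then show ?thesis using universal_extension[OF _ _ that] by blast
  qed
  obtain C where C: "cont_chain K l (le K) \<delta> C M1" "\<forall>i\<in>Field \<delta>. le_u K l (C i) (C (ord_suc \<delta> i))"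
    using M1 unfolding limit_model_def by blast
  have CK: "\<And>i. i \<in> Field \<delta> \<Longrightarrow> C i \<in> K_at K l" and Cinc: "increasing (le K) \<delta> C"
    and CM1: "\<And>i. i \<in> Field \<delta> \<Longrightarrow> le K (C i) M1" and M1eq: "M1 = union_struct V (Field \<delta>) C"
    and M1K: "M1 \<in> K_at K l"
    using C(1) lim(1) unfolding cont_chain_def by blast+
  \<comment> \<open>The chain of \<open>M1\<close> is only known to be universal at successors.
    Between two terms of a cofinal sequence a successor is passed, so the subchain is
    \<open>le_u\<close>-increasing and has the length of the forking chain.\<close>
  obtain c where c: "\<And>j. j \<in> Field ?m \<Longrightarrow> c j \<in> Field \<delta>"
    "\<And>i j. (i, j) \<in> ?m \<Longrightarrow> i \<noteq> j \<Longrightarrow> (c i, c j) \<in> \<delta> \<and> c i \<noteq> c j"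
    "\<And>x. x \<in> Field \<delta> \<Longrightarrow> \<exists>j\<in>Field ?m. (x, c j) \<in> \<delta>"
    using cofinal_sequence[OF lim(1)] by blast
  have leC: "le K (C i) (C j)" if "(i, j) \<in> \<delta>" for i j
  proof (cases "i = j")
    case True
    have "j \<in> Field \<delta>" using that by (auto simp: Field_def)
    then show ?thesis using True le_refl CK K_at_mods by blast
  next
    case False
    then show ?thesis using that Cinc unfolding increasing_def by blast
  qed
  let ?C = "\<lambda>j. C (c j)"
  have incC: "increasing (le_u K l) ?m ?C" unfolding increasing_def
  proof (intro allI impI)
    fix i j assume ij: "(i, j) \<in> ?m \<and> i \<noteq> j"
    then have ijF: "i \<in> Field ?m" "j \<in> Field ?m" by (auto simp: Field_def)
    have "(ord_suc \<delta> (c i), c j) \<in> \<delta>"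
      using ord_suc_props(4)[OF lim(1) c(1)[OF ijF(1)]] c(2) ij by blast
    then show "le_u K l (?C i) (?C j)"
      using le_u_trans2[OF _ leC CK[OF c(1)[OF ijF(2)]]] C(2) c(1)[OF ijF(1)] by blast
  qed
  have UM1: "le K (union_struct V (Field ?m) ?C) M1"
  proof (rule limit_union(3)[OF limm])
    show "\<forall>j\<in>Field ?m. ?C j \<in> mods K" using CK c(1) K_at_mods by blast
    show "increasing (le K) ?m ?C" using incC le_uD(3) unfolding increasing_def by blast
  qed (use CM1 c(1) in blast)
  have "univ (union_struct V (Field ?m) ?C) = univ M1"
  proof
    show "univ (union_struct V (Field ?m) ?C) \<subseteq> univ M1" by (rule le_univ[OF UM1])
    show "univ M1 \<subseteq> univ (union_struct V (Field ?m) ?C)"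
      unfolding M1eq univ_union_struct
    proof (rule UN_least)
      fix x assume "x \<in> Field \<delta>"
      then obtain j where "j \<in> Field ?m" "(x, c j) \<in> \<delta>" using c(3) by blast
      then show "univ (C x) \<subseteq> (\<Union>i\<in>Field ?m. univ (C (c i)))" using le_univ[OF leC] by blast
    qed
  qed
  then have "union_struct V (Field ?m) ?C = M1" using le_univ_eq[OF UM1 le_refl[OF K_at_mods[OF M1K]]] by simp
  then have "isomorphic V ?U M1" using limit_unique[OF limm fml inc incC] by simp
  then have "isomorphic V M2 ?U" using iso isomorphic_sym isomorphic_trans by blast
  then obtain f where f: "struct_iso V f M2 ?U" unfolding isomorphic_def by blast
  obtain E where E: "cont_chain K l (le K) \<epsilon> E M2" "\<forall>i\<in>Field \<epsilon>. le_u K l (E i) (E (ord_suc \<epsilon> i))"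
    using M2 unfolding limit_model_def by blast
  have Einc: "increasing (le K) \<epsilon> E" and EM2: "\<And>i. i \<in> Field \<epsilon> \<Longrightarrow> le K (E i) M2"
    and M2eq: "M2 = union_struct V (Field \<epsilon>) E"
    using E(1) lim(2) unfolding cont_chain_def by blast+
  \<comment> \<open>The chain of \<open>M2\<close> is transported into the union of the forking
    chain.\<close>
  have "\<forall>j\<in>Field \<epsilon>. \<exists>E'. struct_iso V f (E j) E' \<and> le K E' ?U" using le_image[OF EM2 f] by blast
  then obtain E' where E': "\<And>j. j \<in> Field \<epsilon> \<Longrightarrow> struct_iso V f (E j) (E' j)"
    "\<And>j. j \<in> Field \<epsilon> \<Longrightarrow> le K (E' j) ?U" by metis
  show False
  proof (rule forking_chain_not_saturated[OF ue limm m(2) inc U(2) univ_union_struct _ a fork lim(2) _ _ E'(2)])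
    show "le K ?U N" using U(3) MN by blast
    show "increasing (le K) \<epsilon> E'" unfolding increasing_def
    proof (intro allI impI)
      fix i j assume ij: "(i, j) \<in> \<epsilon> \<and> i \<noteq> j"
      then have "i \<in> Field \<epsilon>" "j \<in> Field \<epsilon>" by (auto simp: Field_def)
      then show "le K (E' i) (E' j)" using le_iso E'(1) Einc ij unfolding increasing_def by blast
    qed
    show "le_u K l (E' j) (E' (ord_suc \<epsilon> j))" if "j \<in> Field \<epsilon>" for j
      using le_u_iso[OF _ E'(1)[OF ord_suc_props(1)[OF lim(2) that]] E'(1)[OF that]] E(2) that by blast
    have "univ ?U = f ` univ M2" using struct_isoD(5)[OF f] by simp
    also have "\<dots> = (\<Union>j\<in>Field \<epsilon>. f ` univ (E j))" unfolding M2eq univ_union_struct by blast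
    also have "\<dots> = (\<Union>j\<in>Field \<epsilon>. univ (E' j))" using struct_isoD(5)[OF E'(1)] by simp
    finally show "univ ?U = (\<Union>j\<in>Field \<epsilon>. univ (E' j))" .
    show "\<not> cofinal S \<epsilon>" if "S \<subseteq> Field \<epsilon>" "|S| \<le>o |Field ?m|" for S
      using cf_not_cofinal[OF lim(2) that(1)] ordLeq_ordLess_trans[OF ordLeq_ordIso_trans[OF that(2) fm] de] by blast
  qed
qed

end

text \<open>\<open>kappa\<close> is the least bound, or infinite if there is none, so
  \<open>c\<close> is not itself a bound. As \<open>c\<close> is a cardinal at most
  \<open>l\<close>, only the clause on regular cardinals can fail, and it yields
  \<open>g\<close>.\<close>

lemma less_kappa_obtain:
  assumes "less_inf c (kappa K l I)" "Card_order c" "c \<le>o l"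
  obtains g where "regular_cardinal g" "c \<le>o g" "g <o cardSuc l" "g \<notin> kappa_set K l I"
proof -
  have "\<not> kappa_bound K l I c"
  proof
    assume c: "kappa_bound K l I c"
    let ?P = "\<lambda>m. kappa_bound K l I m \<and> (\<forall>n. kappa_bound K l I n \<longrightarrow> m \<le>o n)"
    have "\<And>m. kappa_bound K l I m \<Longrightarrow> Card_order m" by (simp add: kappa_bound_def)
    then have "\<exists>m. ?P m" using exists_minim_Card_order[of "{m. kappa_bound K l I m}"] c by blast
    then have "?P (SOME m. ?P m)" by (rule someI_ex)
    then have "(SOME m. ?P m) \<le>o c" using c by blast
    moreover have "\<exists>m. kappa_bound K l I m" using c by blast
    then have "c <o (SOME m. ?P m)" using assms(1) unfolding less_inf_def kappa_def by simp
    ultimately show False using not_ordLess_ordLeq by blast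
  qed
  then show ?thesis using assms(2,3) that unfolding kappa_bound_def by blast
qed

theorem theorem4p1:
  fixes K :: "('s, 'a) aec"
    and lam \<kappa> \<delta>1 \<delta>2 :: "'a rel"
    and I :: "('s, 'a) indep"
    and M1 M2 :: "('s, 'a) struct"
  assumes "is_aec K"
    and "Card_order lam" and "LS K \<le>o lam" and "lam <o |UNIV :: 'a set|"
    and "stable_in K lam"
    and "has_amalgamation K lam" and "has_joint_embedding K lam" and "no_maximal_models K lam"
    and "independence_relation K lam I"
    and "has_uniqueness K lam I" and "has_extension K lam I" and "universal_continuity K lam I"
    and "regular_cardinal \<kappa>" and "\<kappa> \<le>o lam" and "geq_local_character K lam I \<kappa>"
    and "tame K natLeq"
    and "limit_ord \<delta>1" and "\<delta>1 <o cardSuc lam"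
    and "limit_ord \<delta>2" and "\<delta>2 <o cardSuc lam"
    and "less_inf (cf \<delta>1) (kappa K lam I)"
    and "\<not> cf \<delta>1 =o cf \<delta>2"
    and "limit_model K lam \<delta>1 M1" and "limit_model K lam \<delta>2 M2"
  shows "\<not> isomorphic (voc K) M1 M2"
proof -
  interpret indep_at K lam I \<kappa>
    by unfold_locales (fact assms)+
  have c1: "Card_order (cf \<delta>1)" and c2: "Card_order (cf \<delta>2)"
    using cf_regular assms(17,19) by (auto simp: regular_cardinal_def)
  obtain g where g: "regular_cardinal g" "cf \<delta>1 \<le>o g" "g <o cardSuc lam" "g \<notin> kappa_set K lam I"
    using less_kappa_obtain[OF assms(21) c1 cf_leq(1)[OF assms(17,2,18)]] by blast
  consider "cf \<delta>1 <o cf \<delta>2" | "cf \<delta>2 <o cf \<delta>1"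
    using c1 c2 assms(22) ordLess_or_ordLeq[of "cf \<delta>1" "cf \<delta>2"] ordLeq_iff_ordLess_or_ordIso ordIso_symmetric
    unfolding card_order_on_def by blast
  then show ?thesis
  proof cases
    case 1
    then show ?thesis using limit_models_not_isomorphic[OF g(1,3,4) g(2) _ assms(23,24)] by blast
  next
    case 2
    \<comment> \<open>\<open>g\<close> is at least \<open>cf \<delta>1\<close>, the larger
      cofinality here, so it also serves for the exchanged pair.\<close>
    then have "cf \<delta>2 \<le>o g" using g(2) ordLess_imp_ordLeq ordLeq_transitive by blast
    then show ?thesis
      using limit_models_not_isomorphic[OF g(1,3,4) _ 2 assms(24,23)] isomorphic_sym by blast
  qed
qed

end
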